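(* A Banach space $E$ is reflexive if and only if the following holds: for every Banach space $F$ and every $T\in\mathcal{L}(E,F)$, $T$ is upper semi-Fredholm if and only if there exists $\delta>0$ such that no normalized basic sequence $(e_n)$ in $E$ satisfies $\|Te_n\|<\delta$ for all $n\in\mathbb{N}$.
   Context: An operator is upper semi-Fredholm if it has finite-dimensional kernel and closed range. A normalized basic sequence is a basic sequence of unit vectors. *)

theory Defs
  imports "HOL-Analysis.Analysis" "HOL-Probability.Discrete_Topology"
begin

definition reflexive_space :: "'e::banach itself \<Rightarrow> bool" where
  "reflexive_space _ \<longleftrightarrow>
     (\<forall>\<phi> :: ('e \<Rightarrow>\<^sub>L real) \<Rightarrow>\<^sub>L real. \<exists>x::'e. \<forall>f. blinfun_apply \<phi> f = blinfun_apply f x)"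

definition finite_dimensional_set :: "'a::real_vector set \<Rightarrow> bool" where
  "finite_dimensional_set S \<longleftrightarrow> (\<exists>B. finite B \<and> S \<subseteq> span B)"

definition upper_semi_fredholm :: "('a::real_normed_vector \<Rightarrow> 'b::real_normed_vector) \<Rightarrow> bool" where
  "upper_semi_fredholm T \<longleftrightarrow>
     finite_dimensional_set {x. T x = 0} \<and> closed (range T)"

definition basic_sequence :: "(nat \<Rightarrow> 'a::real_normed_vector) \<Rightarrow> bool" where
  "basic_sequence e \<longleftrightarrow>
     (\<forall>x \<in> closure (span (range e)). \<exists>!a::nat \<Rightarrow> real. (\<lambda>n. a n *\<^sub>R e n) sums x)"

definition normalized_basic_sequence :: "(nat \<Rightarrow> 'a::real_normed_vector) \<Rightarrow> bool" where
  "normalized_basic_sequence e \<longleftrightarrow> basic_sequence e \<and> (\<forall>n. norm (e n) = 1)"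

definition usf_iff_no_small_basic :: "('a::real_normed_vector \<Rightarrow> 'b::real_normed_vector) \<Rightarrow> bool" where
  "usf_iff_no_small_basic T \<longleftrightarrow>
     (upper_semi_fredholm T \<longleftrightarrow>
       (\<exists>\<delta>>0. \<not> (\<exists>e. normalized_basic_sequence e \<and> (\<forall>n. norm (T (e n)) < \<delta>))))"

end

theory Submission
  imports Defs
begin

text \<open>If \<open>T\<close> is not upper semi-Fredholm, it is not bounded below on any closed subspace of finite
  codimension, and Mazur's selection gives basic sequences on which \<open>T\<close> is arbitrarily small.
  Conversely, let \<open>T\<close> be upper semi-Fredholm. By the open mapping theorem, if \<open>T\<close> is small on
  \<open>(e n)\<close> then \<open>(e n)\<close> stays close to the kernel; compactness of the ball of the kernel
  yields a functional that is bounded away from 0 along a subsequence. This is impossible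
  when \<open>E\<close> is reflexive, since normalized basic sequences are then weakly null.

  If \<open>E\<close> is not reflexive, take \<open>\<phi>\<close> in the bidual but not in \<open>E\<close>. Mazur's selection around \<open>\<phi>\<close>,
  with norm control by Helly's theorem, gives a bounded basic sequence with \<open>f (x n) = 1\<close> for
  a fixed functional \<open>f\<close>. Then \<open>\<epsilon> x n + x 0\<close> is basic up to normalization and nearly lies in the
  one-dimensional kernel of \<open>u \<mapsto> u - f u x 0\<close>, an upper semi-Fredholm operator on \<open>E\<close>; compose it
  with an isometric embedding of \<open>E\<close> into the bounded functions on \<open>E\<close>.\<close>

section \<open>Hahn--Banach\<close>

definition sublinear :: "('a::real_vector \<Rightarrow> real) \<Rightarrow> bool" where
  "sublinear p \<longleftrightarrow> (\<forall>x y. p (x + y) \<le> p x + p y) \<and> (\<forall>t>0. \<forall>x. p (t *\<^sub>R x) = t * p x)"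

text \<open>The inequality for \<open>inverse t\<close> at the point \<open>t *\<^sub>R x\<close>
  supplies the missing half of positive homogeneity.\<close>

lemma sublinearI:
  assumes "\<And>x y. p (x + y) \<le> p x + p y" "\<And>t x. t > 0 \<Longrightarrow> p (t *\<^sub>R x) \<le> t * p x"
  shows "sublinear p"
  unfolding sublinear_def
proof (intro conjI allI impI assms(1))
  fix t :: real and x assume t: "0 < t"
  have "p x = p (inverse t *\<^sub>R t *\<^sub>R x)" using t by simp
  also have "\<dots> \<le> inverse t * p (t *\<^sub>R x)" by (rule assms(2)) (use t in simp)
  finally have "t * p x \<le> p (t *\<^sub>R x)" using t by (simp add: field_simps)
  with assms(2)[OF t, of x] show "p (t *\<^sub>R x) = t * p x" by simp
qed

lemma sublinear_add: "sublinear p \<Longrightarrow> p (x + y) \<le> p x + p y"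
  by (simp add: sublinear_def)

lemma sublinear_0: assumes "sublinear p" shows "p 0 = 0"
proof -
  have "p (2 *\<^sub>R 0) = 2 * p 0" using conjunct2[OF assms[unfolded sublinear_def], rule_format, of 2 0] by simp
  then show ?thesis by simp
qed

lemma sublinear_scaleR: "sublinear p \<Longrightarrow> t \<ge> 0 \<Longrightarrow> p (t *\<^sub>R x) = t * p x"
  using sublinear_0[of p] by (cases "t = 0") (auto simp: sublinear_def)

lemma sublinear_minus: "sublinear p \<Longrightarrow> - p (- x) \<le> p x"
  using sublinear_add[of p x "-x"] sublinear_0[of p] by simp

text \<open>Applied to a minimal \<open>p\<close>, which must equal \<open>q\<close>, this gives \<open>p (- y) = - p y\<close>; hence minimal
  sublinear functionals are linear, and Zorn's lemma is needed only for their existence.\<close>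

lemma sublinear_tangent:
  fixes p :: "'a::real_vector \<Rightarrow> real"
  assumes p: "sublinear p"
  obtains q where "sublinear q" "q \<le> p" "q (- y) \<le> - p y"
proof -
  \<comment> \<open>\<open>q\<close> is the infimal convolution of \<open>p\<close> with the
    function taking the value \<open>- t * p y\<close> at \<open>- t *\<^sub>R y\<close>. The choice
    \<open>t = 0\<close> gives \<open>q \<le> p\<close>, and \<open>t = 1\<close> at
    \<open>- y\<close> gives the last claim.\<close>
  define q where "q x = (INF t\<in>{0..}. p (x + t *\<^sub>R y) - t * p y)" for x
  have bdd: "bdd_below ((\<lambda>t. p (x + t *\<^sub>R y) - t * p y) ` {0..})" for x
  proof (rule bdd_belowI2)
    fix t :: real assume "t \<in> {0..}"
    then have "t * p y = p ((x + t *\<^sub>R y) + (- x))" using sublinear_scaleR[OF p, of t y] by simp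
    also have "\<dots> \<le> p (x + t *\<^sub>R y) + p (-x)" by (rule sublinear_add[OF p])
    finally show "- p (-x) \<le> p (x + t *\<^sub>R y) - t * p y" by simp
  qed
  have le: "q x \<le> p (x + t *\<^sub>R y) - t * p y" if "t \<ge> 0" for x t
    unfolding q_def by (rule cINF_lower[OF bdd]) (use that in auto)
  have ge: "c \<le> q x" if "\<And>t. t \<ge> 0 \<Longrightarrow> c \<le> p (x + t *\<^sub>R y) - t * p y" for c x
    unfolding q_def by (rule cINF_greatest) (use that in auto)
  have "sublinear q"
  proof (rule sublinearI)
    fix u v
    have *: "q (u + v) \<le> (p (u + s *\<^sub>R y) - s * p y) + (p (v + t *\<^sub>R y) - t * p y)"
      if "s \<ge> 0" "t \<ge> 0" for s t
    proof -
      have "q (u + v) \<le> p ((u + v) + (s + t) *\<^sub>R y) - (s + t) * p y"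
        by (rule le) (use that in simp)
      also have "(u + v) + (s + t) *\<^sub>R y = (u + s *\<^sub>R y) + (v + t *\<^sub>R y)"
        by (simp add: algebra_simps)
      finally show ?thesis
        using sublinear_add[OF p, of "u + s *\<^sub>R y" "v + t *\<^sub>R y"] by (simp add: algebra_simps)
    qed
    \<comment> \<open>The two infima are taken one at a time: over \<open>t\<close> for fixed
      \<open>s\<close>, then over \<open>s\<close>.\<close>
    have "q (u + v) - q v \<le> q u"
    proof (rule ge)
      fix s :: real assume s: "s \<ge> 0"
      have "q (u + v) - (p (u + s *\<^sub>R y) - s * p y) \<le> q v"
        by (rule ge) (use *[OF s] in \<open>simp add: algebra_simps\<close>)
      then show "q (u + v) - q v \<le> p (u + s *\<^sub>R y) - s * p y" by simp
    qed
    then show "q (u + v) \<le> q u + q v" by simp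
  next
    fix t :: real and x assume t: "t > 0"
    have "q (t *\<^sub>R x) / t \<le> q x"
    proof (rule ge)
      fix s :: real assume s: "s \<ge> 0"
      have "q (t *\<^sub>R x) \<le> p (t *\<^sub>R x + (t * s) *\<^sub>R y) - (t * s) * p y"
        by (rule le) (use s t in simp)
      also have "t *\<^sub>R x + (t * s) *\<^sub>R y = t *\<^sub>R (x + s *\<^sub>R y)" by (simp add: algebra_simps)
      also have "p \<dots> = t * p (x + s *\<^sub>R y)" using sublinear_scaleR[OF p] t by simp
      finally show "q (t *\<^sub>R x) / t \<le> p (x + s *\<^sub>R y) - s * p y"
        using t by (simp add: field_simps)
    qed
    then show "q (t *\<^sub>R x) \<le> t * q x" using t by (simp add: field_simps)
  qed
  moreover have "q \<le> p" by (rule le_funI) (use le[of 0] in simp)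
  moreover have "q (- y) \<le> - p y" using le[of 1 "- y"] sublinear_0[OF p] by simp
  ultimately show ?thesis by (rule that)
qed

text \<open>Zorn's lemma for the reversed pointwise order. A nonempty chain is bounded by its
  pointwise infimum, which is finite because \<open>- p (- x) \<le> - q (- x) \<le> q x\<close> for
  each member \<open>q\<close>.\<close>

lemma ex_minimal_sublinear:
  fixes p :: "'a::real_vector \<Rightarrow> real"
  assumes p: "sublinear p"
  obtains q where "sublinear q" "q \<le> p" "\<And>r. sublinear r \<Longrightarrow> r \<le> q \<Longrightarrow> r = q"
proof -
  define A where "A = {q. sublinear q \<and> q \<le> p}"
  have "\<exists>m\<in>A. \<forall>a\<in>A. m \<ge> a \<longrightarrow> a = m"
  proof (rule predicate_Zorn)
    show "partial_order_on A (relation_of (\<ge>) A)"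
      by (rule partial_order_on_relation_ofI) auto
  next
    fix C assume "C \<in> Chains (relation_of (\<ge>) A)"
    then have CA: "C \<subseteq> A" and ch: "\<And>q r. q \<in> C \<Longrightarrow> r \<in> C \<Longrightarrow> q \<le> r \<or> r \<le> q"
      unfolding Chains_def relation_of_def by auto
    show "\<exists>u\<in>A. \<forall>a\<in>C. a \<ge> u"
    proof (cases "C = {}")
      case True
      then show ?thesis using p by (auto simp: A_def)
    next
      case False
      define u where "u x = (INF q\<in>C. q x)" for x
      have bdd: "bdd_below ((\<lambda>q. q x) ` C)" for x
      proof (rule bdd_belowI2)
        fix q assume "q \<in> C"
        then have q: "sublinear q" "q \<le> p" using CA by (auto simp: A_def)
        have "q (- x) \<le> p (- x)" using q(2) by (rule le_funD)
        then show "- p (- x) \<le> q x" using sublinear_minus[OF q(1), of x] by simp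
      qed
      have le: "u x \<le> q x" if "q \<in> C" for q x
        unfolding u_def by (rule cINF_lower[OF bdd that])
      have ge: "c \<le> u x" if "\<And>q. q \<in> C \<Longrightarrow> c \<le> q x" for c x
        unfolding u_def by (rule cINF_greatest[OF False that])
      have sl: "sublinear q" if "q \<in> C" for q using that CA by (auto simp: A_def)
      have "sublinear u"
      proof (rule sublinearI)
        fix x y
        \<comment> \<open>An infimum of sublinear functionals need not be subadditive; in a chain,
          the smaller of \<open>q\<close> and \<open>r\<close> serves for both.\<close>
        have *: "u (x + y) \<le> q x + r y" if qr: "q \<in> C" "r \<in> C" for q r
        proof -
          obtain s where s: "s \<in> C" "s \<le> q" "s \<le> r" using ch[OF qr] qr by auto
          have "u (x + y) \<le> s (x + y)" by (rule le[OF s(1)])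
          also have "\<dots> \<le> s x + s y" by (rule sublinear_add[OF sl[OF s(1)]])
          also have "\<dots> \<le> q x + r y" by (rule add_mono[OF le_funD[OF s(2)] le_funD[OF s(3)]])
          finally show ?thesis .
        qed
        have "u (x + y) - u y \<le> u x"
        proof (rule ge)
          fix q assume q: "q \<in> C"
          have "u (x + y) - q x \<le> u y"
            by (rule ge) (use *[OF q] in \<open>simp add: algebra_simps\<close>)
          then show "u (x + y) - u y \<le> q x" by simp
        qed
        then show "u (x + y) \<le> u x + u y" by simp
      next
        fix t :: real and x assume t: "t > 0"
        have "u (t *\<^sub>R x) / t \<le> u x"
        proof (rule ge)
          fix q assume q: "q \<in> C"
          have "u (t *\<^sub>R x) \<le> q (t *\<^sub>R x)" by (rule le[OF q])
          also have "\<dots> = t * q x" using sublinear_scaleR[OF sl[OF q]] t by simp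
          finally show "u (t *\<^sub>R x) / t \<le> q x" using t by (simp add: field_simps)
        qed
        then show "u (t *\<^sub>R x) \<le> t * u x" using t by (simp add: field_simps)
      qed
      moreover obtain q where "q \<in> C" using False by auto
      then have "u x \<le> p x" for x
        using le[of q x] CA le_funD[of q p x] by (auto simp: A_def)
      ultimately have "u \<in> A" by (simp add: A_def le_fun_def)
      moreover have "\<forall>a\<in>C. u \<le> a" using le by (blast intro: le_funI)
      ultimately show ?thesis by blast
    qed
  qed
  then obtain m where m: "m \<in> A" "\<And>a. a \<in> A \<Longrightarrow> a \<le> m \<Longrightarrow> a = m" by auto
  show ?thesis
  proof (rule that)
    show "sublinear m" "m \<le> p" using m(1) by (auto simp: A_def)
    show "r = m" if "sublinear r" "r \<le> m" for r
      using m that by (auto simp: A_def intro: order_trans)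
  qed
qed

text \<open>This form replaces extension from a subspace: vanishing on a subspace is encoded in a
  \<open>p\<close> that vanishes there, such as the distance to it.\<close>

theorem hahn_banach_sublinear:
  fixes p :: "'a::real_vector \<Rightarrow> real"
  assumes p: "sublinear p"
  obtains f where "linear f" "\<And>x. f x \<le> p x" "f y = p y"
proof -
  \<comment> \<open>Starting below the tangent at \<open>y\<close> secures equality there: a linear
    \<open>f \<le> q\<close> has \<open>- f y \<le> - p y\<close>.\<close>
  obtain q where q: "sublinear q" "q \<le> p" "q (- y) \<le> - p y" by (rule sublinear_tangent[OF p])
  obtain f where f: "sublinear f" "f \<le> q" and min: "\<And>r. sublinear r \<Longrightarrow> r \<le> f \<Longrightarrow> r = f"
    by (rule ex_minimal_sublinear[OF q(1)]) blast
  have neg: "f (- x) = - f x" for x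
  proof -
    obtain r where r: "sublinear r" "r \<le> f" "r (- x) \<le> - f x" by (rule sublinear_tangent[OF f(1)])
    with min[OF r(1,2)] have "f (- x) \<le> - f x" by simp
    with sublinear_minus[OF f(1), of x] show ?thesis by simp
  qed
  have add: "f (x + z) = f x + f z" for x z
    using sublinear_add[OF f(1), of x z] sublinear_add[OF f(1), of "- x" "- z"] neg[of "x + z"]
    by (simp add: neg)
  have "linear f"
  proof (rule linearI[OF add])
    fix t :: real and x
    show "f (t *\<^sub>R x) = t *\<^sub>R f x"
    proof (cases "t \<ge> 0")
      case True then show ?thesis using sublinear_scaleR[OF f(1)] by simp
    next
      case False
      then have "f ((- t) *\<^sub>R x) = - t * f x" using sublinear_scaleR[OF f(1), of "-t"] by simp
      then show ?thesis using neg[of "t *\<^sub>R x"] by simp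
    qed
  qed
  moreover have fp: "f x \<le> p x" for x using le_funD[OF f(2), of x] le_funD[OF q(2), of x] by simp
  moreover have "f y = p y"
    using fp[of y] le_funD[OF f(2), of "- y"] q(3) neg[of y] by simp
  ultimately show ?thesis by (rule that)
qed

lemma hahn_banach_blinfun:
  fixes p :: "'a::real_normed_vector \<Rightarrow> real"
  assumes p: "sublinear p" and K: "\<And>x. p x \<le> K * norm x"
  obtains f :: "'a \<Rightarrow>\<^sub>L real" where "\<And>x. f x \<le> p x" "f y = p y"
proof -
  obtain f where f: "linear f" "\<And>x. f x \<le> p x" "f y = p y" by (rule hahn_banach_sublinear[OF p]) blast
  have "\<bar>f x\<bar> \<le> K * norm x" for x
    using f(2)[of x] f(2)[of "- x"] K[of x] K[of "- x"] linear_neg[OF f(1), of x] by simp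
  then have bl: "bounded_linear f"
    using f(1) by (intro bounded_linear_intro[where K = K]) (auto simp: linear_add linear_scale mult.commute)
  show ?thesis
    by (rule that[of "Blinfun f"]) (use f bounded_linear_Blinfun_apply[OF bl] in auto)
qed

section \<open>Functionals attaining a norm or a distance\<close>

lemma norm_blinfun_le_1I:
  fixes f :: "'a::real_normed_vector \<Rightarrow>\<^sub>L real"
  assumes "\<And>x. f x \<le> norm x"
  shows "norm f \<le> 1"
proof (rule norm_blinfun_bound)
  show "norm (f x) \<le> 1 * norm x" for x
    using assms[of x] assms[of "- x"] by (simp add: blinfun.minus_right)
qed simp

lemma norming_functional:
  fixes y :: "'a::real_normed_vector"
  obtains f :: "'a \<Rightarrow>\<^sub>L real" where "norm f \<le> 1" "f y = norm y"
proof -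
  have "sublinear (norm :: 'a \<Rightarrow> real)" by (rule sublinearI) (auto intro: norm_triangle_ineq)
  then obtain f :: "'a \<Rightarrow>\<^sub>L real" where "\<And>x. f x \<le> norm x" "f y = norm y"
    by (rule hahn_banach_blinfun[where K = 1]) auto
  then show ?thesis using that norm_blinfun_le_1I by blast
qed

lemma infdist_subspace_sublinear:
  fixes V :: "'a::real_normed_vector set"
  assumes V: "subspace V"
  shows "sublinear (\<lambda>x. infdist x V)"
proof (rule sublinearI)
  have ne: "V \<noteq> {}" using subspace_0[OF V] by auto
  have ge: "c \<le> infdist x V" if "\<And>a. a \<in> V \<Longrightarrow> c \<le> dist x a" for c x
    unfolding infdist_notempty[OF ne] by (rule cINF_greatest[OF ne that])
  fix x y
  have *: "infdist (x + y) V \<le> dist x a + dist y b" if "a \<in> V" "b \<in> V" for a b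
  proof -
    have "infdist (x + y) V \<le> dist (x + y) (a + b)"
      by (rule infdist_le) (use V that in \<open>simp add: subspace_add\<close>)
    also have "\<dots> \<le> dist x a + dist y b" by (rule dist_triangle_add)
    finally show ?thesis .
  qed
  have "infdist (x + y) V - infdist y V \<le> infdist x V"
  proof (rule ge)
    fix a assume a: "a \<in> V"
    have "infdist (x + y) V - dist x a \<le> infdist y V"
      by (rule ge) (use *[OF a] in \<open>simp add: algebra_simps\<close>)
    then show "infdist (x + y) V - infdist y V \<le> dist x a" by simp
  qed
  then show "infdist (x + y) V \<le> infdist x V + infdist y V" by simp
  fix t :: real assume t: "t > 0"
  have "infdist (t *\<^sub>R x) V / t \<le> infdist x V"
  proof (rule ge)
    fix a assume a: "a \<in> V"
    have "infdist (t *\<^sub>R x) V \<le> dist (t *\<^sub>R x) (t *\<^sub>R a)"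
      by (rule infdist_le) (use V a in \<open>simp add: subspace_scale\<close>)
    also have "\<dots> = t * dist x a"
      using t by (simp add: dist_norm flip: scaleR_diff_right)
    finally show "infdist (t *\<^sub>R x) V / t \<le> dist x a" using t by (simp add: field_simps)
  qed
  then show "infdist (t *\<^sub>R x) V \<le> t * infdist x V" using t by (simp add: field_simps)
qed

text \<open>The dominating functional is the distance to \<open>V\<close>, the seminorm of the
  quotient by \<open>V\<close>. It is 0 at \<open>x\<close> and at \<open>- x\<close> for
  \<open>x\<close> in \<open>V\<close>, so a linear functional below it vanishes on
  \<open>V\<close>.\<close>

lemma infdist_functional:
  fixes V :: "'a::real_normed_vector set"
  assumes V: "subspace V"
  obtains f :: "'a \<Rightarrow>\<^sub>L real" where "norm f \<le> 1" "\<And>x. x \<in> V \<Longrightarrow> f x = 0" "f y = infdist y V"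
proof -
  have le: "infdist x V \<le> norm x" for x
    using infdist_le[OF subspace_0[OF V], of x] by simp
  obtain f :: "'a \<Rightarrow>\<^sub>L real" where f: "\<And>x. f x \<le> infdist x V" "f y = infdist y V"
    by (rule hahn_banach_blinfun[OF infdist_subspace_sublinear[OF V], of 1]) (use le in auto)
  show ?thesis
  proof (rule that[OF _ _ f(2)])
    show "norm f \<le> 1" using f(1) le by (intro norm_blinfun_le_1I) (rule order_trans)
    fix x assume x: "x \<in> V"
    then have "- x \<in> V" using V by (simp add: subspace_neg)
    with x f(1)[of x] f(1)[of "- x"] show "f x = 0" by (simp add: blinfun.minus_right)
  qed
qed

section \<open>Finite-dimensional subspaces and finite sets of functionals\<close>

lemma closed_subspace_functional:
  fixes V :: "'a::real_normed_vector set"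
  assumes V: "subspace V" "closed V" and b: "b \<notin> V"
  obtains h :: "'a \<Rightarrow>\<^sub>L real" where "\<And>x. x \<in> V \<Longrightarrow> h x = 0" "h b = 1"
proof -
  obtain f :: "'a \<Rightarrow>\<^sub>L real" where f: "\<And>x. x \<in> V \<Longrightarrow> f x = 0" "f b = infdist b V"
    by (rule infdist_functional[OF V(1)]) blast
  have "infdist b V > 0"
    using infdist_pos_not_in_closed[OF V(2) _ b] subspace_0[OF V(1)] by auto
  then show ?thesis
    by (intro that[of "inverse (infdist b V) *\<^sub>R f"]) (auto simp: f blinfun.scaleR_left)
qed

text \<open>A functional \<open>h\<close> that vanishes on the closed span \<open>?W\<close> with
  \<open>h b = 1\<close> reads off the coefficient of \<open>b\<close>. Hence the span enlarged by
  \<open>b\<close> is the preimage of \<open>?W\<close> under a continuous map.\<close>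

lemma closed_span_Un_finite:
  fixes V :: "'a::real_normed_vector set"
  assumes V: "closed (span V)" and B: "finite B"
  shows "closed (span (V \<union> B))"
  using B
proof induction
  case empty
  then show ?case using V by simp
next
  case (insert b B)
  let ?W = "span (V \<union> B)"
  have eq: "V \<union> insert b B = insert b (V \<union> B)" by simp
  show ?case
  proof (cases "b \<in> ?W")
    case True
    then show ?thesis unfolding eq using insert.IH by (simp add: span_redundant)
  next
    case False
    obtain h :: "'a \<Rightarrow>\<^sub>L real" where h: "\<And>x. x \<in> ?W \<Longrightarrow> h x = 0" "h b = 1"
      by (rule closed_subspace_functional[OF subspace_span insert.IH False]) blast
    have "span (insert b (V \<union> B)) = (\<lambda>x. x - h x *\<^sub>R b) -` ?W"
    proof (intro set_eqI iffI)
      fix x assume "x \<in> span (insert b (V \<union> B))"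
      then obtain k where k: "x - k *\<^sub>R b \<in> ?W" unfolding span_insert by blast
      with h(1)[OF k] h(2) have "h x = k"
        by (simp add: blinfun.diff_right blinfun.scaleR_right)
      with k show "x \<in> (\<lambda>x. x - h x *\<^sub>R b) -` ?W" by simp
    next
      fix x assume "x \<in> (\<lambda>x. x - h x *\<^sub>R b) -` ?W"
      then show "x \<in> span (insert b (V \<union> B))" unfolding span_insert by blast
    qed
    moreover have "closed \<dots>"
      by (intro continuous_closed_vimage[OF insert.IH]) (auto intro!: continuous_intros)
    ultimately show ?thesis by simp
  qed
qed

lemma closed_span_finite:
  fixes B :: "'a::real_normed_vector set"
  shows "finite B \<Longrightarrow> closed (span B)"
  using closed_span_Un_finite[of "{}" B] by simp

text \<open>The coefficient of \<open>b\<close> in a vector of norm at most \<open>R\<close> is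
  bounded by \<open>C = norm h * R\<close>, so the ball is a closed subset of a continuous image of
  a compact product. The radius varies in the induction because the remainder may have norm up to
  \<open>R + C * norm b\<close>.\<close>

lemma compact_cball_span_finite:
  fixes B :: "'a::real_normed_vector set"
  assumes "finite B"
  shows "compact {x \<in> span B. norm x \<le> R}"
  using assms
proof (induction arbitrary: R)
  case empty
  have "{x::'a. x = 0 \<and> norm x \<le> R} = (if R \<ge> 0 then {0} else {})" by auto
  then show ?case by simp
next
  case (insert b B)
  show ?case
  proof (cases "b \<in> span B")
    case True
    then show ?thesis using insert.IH by (simp add: span_redundant)
  next
    case False
    obtain h :: "'a \<Rightarrow>\<^sub>L real" where h: "\<And>x. x \<in> span B \<Longrightarrow> h x = 0" "h b = 1"
      by (rule closed_subspace_functional[OF subspace_span closed_span_finite[OF insert.hyps(1)] False]) blast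
    define C where "C = norm h * R"
    define K where "K = (\<lambda>(y, t). y + t *\<^sub>R b) `
      ({y \<in> span B. norm y \<le> R + C * norm b} \<times> {- C..C})"
    have "compact K" unfolding K_def
      by (intro compact_continuous_image compact_Times insert.IH)
        (auto intro!: continuous_intros simp: case_prod_unfold)
    moreover have "closed {x \<in> span (insert b B). norm x \<le> R}"
    proof -
      have "{x \<in> span (insert b B). norm x \<le> R} = span (insert b B) \<inter> cball 0 R" by auto
      then show ?thesis using closed_span_finite[of "insert b B"] insert.hyps(1) by (simp add: closed_Int)
    qed
    moreover have "{x \<in> span (insert b B). norm x \<le> R} \<subseteq> K"
    proof safe
      fix x assume x: "x \<in> span (insert b B)" "norm x \<le> R"
      then obtain k where k: "x - k *\<^sub>R b \<in> span B" unfolding span_insert by blast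
      with h(1)[OF k] h(2) have hx: "h x = k"
        by (simp add: blinfun.diff_right blinfun.scaleR_right)
      have "\<bar>k\<bar> \<le> norm h * norm x" using norm_blinfun[of h x] hx by simp
      also have "\<dots> \<le> C" unfolding C_def by (intro mult_left_mono x(2)) simp
      finally have kC: "\<bar>k\<bar> \<le> C" .
      have "norm (x - k *\<^sub>R b) \<le> norm x + \<bar>k\<bar> * norm b"
        using norm_triangle_ineq4[of x "k *\<^sub>R b"] by simp
      also have "\<dots> \<le> R + C * norm b" by (intro add_mono x(2) mult_right_mono kC) simp
      finally have "(x - k *\<^sub>R b, k) \<in> {y \<in> span B. norm y \<le> R + C * norm b} \<times> {- C..C}"
        using k kC by auto
      then have "(\<lambda>(y, t). y + t *\<^sub>R b) (x - k *\<^sub>R b, k) \<in> K" unfolding K_def by (rule imageI)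
      then show "x \<in> K" by simp
    qed
    ultimately have "compact (K \<inter> {x \<in> span (insert b B). norm x \<le> R})"
      "K \<inter> {x \<in> span (insert b B). norm x \<le> R} = {x \<in> span (insert b B). norm x \<le> R}"
      by (auto intro!: compact_Int_closed simp del: Int_Collect)
    then show ?thesis by simp
  qed
qed

section \<open>Common kernels of finitely many functionals\<close>

abbreviation common_kernel :: "('a::real_normed_vector \<Rightarrow>\<^sub>L real) set \<Rightarrow> 'a set" where
  "common_kernel G \<equiv> {x. \<forall>g\<in>G. blinfun_apply g x = 0}"

lemma subspace_common_kernel: "subspace (common_kernel G)"
  by (auto simp: subspace_def blinfun.add_right blinfun.scaleR_right)

lemma closed_common_kernel: "closed (common_kernel G)"
proof -
  have "common_kernel G = (\<Inter>g\<in>G. blinfun_apply g -` {0})" by auto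
  also have "closed \<dots>"
    by (intro closed_INT ballI continuous_closed_vimage) (auto intro!: continuous_intros)
  finally show ?thesis .
qed

text \<open>Each further functional costs at most one vector \<open>v\<close>, along which its value
  can be corrected. Working inside \<open>K\<close> lets the lemma serve both for the kernel of an
  operator and for the whole space.\<close>

lemma finite_codim_common_kernel:
  fixes K :: "'a::real_normed_vector set"
  assumes G: "finite G" and K: "subspace K"
  shows "\<exists>B. finite B \<and> B \<subseteq> K \<and> K \<subseteq> span (K \<inter> common_kernel G \<union> B)"
  using G
proof induction
  case empty
  then show ?case by (intro exI[of _ "{}"]) (simp add: span_superset)
next
  case (insert g G)
  then obtain B where B: "finite B" "B \<subseteq> K" "K \<subseteq> span (K \<inter> common_kernel G \<union> B)" by blast
  show ?case
  proof (cases "\<exists>v\<in>K \<inter> common_kernel G. blinfun_apply g v \<noteq> 0")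
    case False
    then have "K \<inter> common_kernel (insert g G) = K \<inter> common_kernel G" by auto
    then show ?thesis using B by (intro exI[of _ B]) simp
  next
    case True
    then obtain v where v: "v \<in> K" "v \<in> common_kernel G" "g v \<noteq> 0" by blast
    let ?S = "span (K \<inter> common_kernel (insert g G) \<union> insert v B)"
    have "x \<in> ?S" if x: "x \<in> K \<inter> common_kernel G" for x
    proof -
      have "x - (g x / g v) *\<^sub>R v \<in> K"
        using x v K by (auto intro!: subspace_diff subspace_scale)
      then have "x - (g x / g v) *\<^sub>R v \<in> K \<inter> common_kernel (insert g G)"
        using x v by (auto simp: blinfun.diff_right blinfun.scaleR_right)
      then have "x - (g x / g v) *\<^sub>R v \<in> ?S" by (simp add: span_base)
      moreover have "(g x / g v) *\<^sub>R v \<in> ?S" by (simp add: span_base span_scale)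
      ultimately have "(x - (g x / g v) *\<^sub>R v) + (g x / g v) *\<^sub>R v \<in> ?S" by (rule span_add)
      then show ?thesis by simp
    qed
    moreover have "B \<subseteq> ?S" by (auto intro: span_base)
    ultimately have "span (K \<inter> common_kernel G \<union> B) \<subseteq> ?S" by (intro span_minimal) auto
    then have "K \<subseteq> ?S" using B(3) by (rule order_trans[rotated])
    then show ?thesis using B(1,2) v(1) by (intro exI[of _ "insert v B"]) simp
  qed
qed

text \<open>Every \<open>x\<close> in the common kernel of \<open>G\<close> can be moved along
  \<open>v\<close> into the kernel of \<open>g\<close>, where \<open>h\<close> vanishes. Hence
  \<open>h\<close> agrees with a multiple of \<open>g\<close> on the common kernel of
  \<open>G\<close>, and the induction hypothesis applies to the difference.\<close>

lemma in_span_if_vanishes_on_common_kernel: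
  fixes h :: "'a::real_normed_vector \<Rightarrow>\<^sub>L real"
  assumes "finite G" "\<And>x. x \<in> common_kernel G \<Longrightarrow> h x = 0"
  shows "h \<in> span G"
  using assms
proof (induction arbitrary: h)
  case empty
  then have "h = 0" by (intro blinfun_eqI) simp
  then show ?case by simp
next
  case (insert g G)
  show ?case
  proof (cases "\<exists>v\<in>common_kernel G. blinfun_apply g v \<noteq> 0")
    case False
    then have "h \<in> span G" using insert.prems by (intro insert.IH) auto
    then show ?thesis using span_mono[of G "insert g G"] by auto
  next
    case True
    then obtain v where v: "v \<in> common_kernel G" "g v \<noteq> 0" by blast
    have "h - (h v / g v) *\<^sub>R g \<in> span G"
    proof (rule insert.IH)
      fix x assume x: "x \<in> common_kernel G"
      have "x - (g x / g v) *\<^sub>R v \<in> common_kernel (insert g G)"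
        using x v by (auto simp: blinfun.diff_right blinfun.scaleR_right)
      from insert.prems[OF this] show "(h - (h v / g v) *\<^sub>R g) x = 0"
        by (simp add: blinfun.diff_right blinfun.scaleR_right blinfun.diff_left blinfun.scaleR_left)
    qed
    then show ?thesis unfolding span_insert by blast
  qed
qed

text \<open>If \<open>g\<close> vanishes on the common kernel of \<open>G\<close>, it lies in
  \<open>span G\<close> and linearity of \<open>\<phi>\<close> makes its condition automatic.
  Otherwise \<open>x\<close> is corrected along a \<open>v\<close> that the conditions for
  \<open>G\<close> do not see.\<close>

lemma interpolate_finite:
  fixes \<phi> :: "('a::real_normed_vector \<Rightarrow>\<^sub>L real) \<Rightarrow> real"
  assumes "finite G" and \<phi>: "linear \<phi>"
  shows "\<exists>x. \<forall>g\<in>G. blinfun_apply g x = \<phi> g"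
  using assms(1)
proof induction
  case empty
  then show ?case by simp
next
  case (insert g G)
  then obtain x where x: "\<forall>g\<in>G. blinfun_apply g x = \<phi> g" by blast
  show ?case
  proof (cases "\<exists>v\<in>common_kernel G. blinfun_apply g v \<noteq> 0")
    case False
    then have "g \<in> span G"
      by (intro in_span_if_vanishes_on_common_kernel insert.hyps) auto
    then have "g x = \<phi> g"
    proof (induction rule: span_induct)
      case base
      show ?case using \<phi>
        by (auto simp: subspace_def blinfun.add_left blinfun.scaleR_left linear_0 linear_add linear_scale)
    next
      case (step g)
      then show ?case using x by blast
    qed
    with x show ?thesis by auto
  next
    case True
    then obtain v where v: "v \<in> common_kernel G" "g v \<noteq> 0" by blast
    show ?thesis
      by (rule exI[of _ "x + ((\<phi> g - g x) / g v) *\<^sub>R v"])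
        (use x v in \<open>auto simp: blinfun.add_right blinfun.scaleR_right\<close>)
  qed
qed

text \<open>For any interpolating \<open>x\<close>, the distance to the common kernel equals
  \<open>h x\<close> for some \<open>h\<close> vanishing on that kernel. Such an \<open>h\<close> is
  in \<open>span G\<close>, so \<open>h x = \<phi> h \<le> norm \<phi>\<close>. Subtracting a nearly
  closest kernel element keeps the interpolation; the \<open>+ 1\<close> allows for a distance that
  is not attained.\<close>

theorem helly:
  fixes \<phi> :: "('a::real_normed_vector \<Rightarrow>\<^sub>L real) \<Rightarrow>\<^sub>L real"
  assumes G: "finite G"
  obtains x where "norm x \<le> norm \<phi> + 1" "\<And>g. g \<in> G \<Longrightarrow> blinfun_apply g x = \<phi> g"
proof -
  have "linear (blinfun_apply \<phi>)" using blinfun.bounded_linear_right bounded_linear.linear by blast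
  then obtain x where x: "\<forall>g\<in>G. blinfun_apply g x = \<phi> g" using interpolate_finite[OF G] by blast
  let ?N = "common_kernel G"
  obtain h :: "'a \<Rightarrow>\<^sub>L real" where h: "norm h \<le> 1" "\<And>y. y \<in> ?N \<Longrightarrow> h y = 0" "h x = infdist x ?N"
    by (rule infdist_functional[OF subspace_common_kernel]) blast
  have "h \<in> span G" by (rule in_span_if_vanishes_on_common_kernel[OF G h(2)])
  then have "blinfun_apply h x = \<phi> h"
  proof (induction rule: span_induct)
    case base
    show ?case
      by (auto simp: subspace_def blinfun.add_left blinfun.scaleR_left blinfun.add_right blinfun.scaleR_right)
  next
    case (step g)
    then show ?case using x by blast
  qed
  also have "\<phi> h \<le> norm \<phi> * norm h" using norm_blinfun[of \<phi> h] by simp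
  also have "\<dots> \<le> norm \<phi> * 1" by (intro mult_left_mono h(1)) simp
  finally have lt: "infdist x ?N < norm \<phi> + 1" using h(3) by simp
  have ne: "?N \<noteq> {}" using subspace_0[OF subspace_common_kernel, of G] by blast
  obtain a where a: "a \<in> ?N" "dist x a < norm \<phi> + 1"
    using lt unfolding infdist_notempty[OF ne] by (subst (asm) cINF_less_iff[OF ne]) (auto intro!: bdd_belowI2[of _ 0])
  show ?thesis
    by (rule that[of "x - a"]) (use a x in \<open>auto simp: dist_norm blinfun.diff_right\<close>)
qed

text \<open>The unit sphere \<open>?S\<close> of \<open>span B\<close> is compact and is covered by
  the open sets on which some \<open>g\<close> of the unit ball exceeds half the norm.\<close>

lemma finite_half_norming_set:
  fixes B :: "(('a::real_normed_vector \<Rightarrow>\<^sub>L real) \<Rightarrow>\<^sub>L real) set"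
  assumes B: "finite B"
  shows "\<exists>G. finite G \<and> (\<forall>g\<in>G. norm g \<le> 1) \<and> (\<forall>\<psi>\<in>span B. \<exists>g\<in>G. norm \<psi> \<le> 2 * \<bar>blinfun_apply \<psi> g\<bar>)"
proof -
  let ?S = "{\<psi> \<in> span B. norm \<psi> \<le> 1} \<inter> - ball 0 1"
  let ?U = "\<lambda>g. {\<psi> :: ('a \<Rightarrow>\<^sub>L real) \<Rightarrow>\<^sub>L real. 1 / 2 < \<bar>\<psi> g\<bar>}"
  let ?D = "{g :: 'a \<Rightarrow>\<^sub>L real. norm g \<le> 1}"
  have cover: "?S \<subseteq> (\<Union>g\<in>?D. ?U g)"
  proof
    fix \<psi> assume "\<psi> \<in> ?S"
    then have n: "norm \<psi> = 1" by simp
    show "\<psi> \<in> (\<Union>g\<in>?D. ?U g)"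
    proof (rule ccontr)
      assume "\<psi> \<notin> (\<Union>g\<in>?D. ?U g)"
      then have le: "\<bar>\<psi> g\<bar> \<le> 1 / 2" if "norm g \<le> 1" for g using that by force
      have "norm \<psi> \<le> 1 / 2"
      proof (rule norm_blinfun_bound)
        fix f
        show "norm (\<psi> f) \<le> 1 / 2 * norm f"
        proof (cases "f = 0")
          case False
          then show ?thesis using le[of "inverse (norm f) *\<^sub>R f"]
            by (simp add: blinfun.scaleR_right abs_mult field_simps)
        qed simp
      qed simp
      with n show False by simp
    qed
  qed
  have cmp: "compact ?S" using compact_cball_span_finite[OF B] by (intro compact_Int_closed closed_Compl open_ball)
  have op: "open (?U g)" for g by (intro open_Collect_less continuous_intros)
  obtain G where G: "G \<subseteq> ?D" "finite G" "?S \<subseteq> (\<Union>g\<in>G. ?U g)"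
    by (rule compactE_image[OF cmp op cover])
  \<comment> \<open>Inserting \<open>0\<close> provides a witness for \<open>\<psi> = 0\<close> even
    when \<open>G\<close> is empty.\<close>
  have "\<exists>g\<in>insert 0 G. norm \<psi> \<le> 2 * \<bar>\<psi> g\<bar>" if \<psi>: "\<psi> \<in> span B" for \<psi>
  proof (cases "\<psi> = 0")
    case False
    then have "inverse (norm \<psi>) *\<^sub>R \<psi> \<in> ?S" using \<psi> by (simp add: span_scale)
    then obtain g where g: "g \<in> G" "1 / 2 < \<bar>(inverse (norm \<psi>) *\<^sub>R \<psi>) g\<bar>" using G(3) by blast
    then have "norm \<psi> \<le> 2 * \<bar>\<psi> g\<bar>"
      using False by (simp add: blinfun.scaleR_left abs_mult field_simps)
    with g(1) show ?thesis by blast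
  qed auto
  then show ?thesis using G by (intro exI[of _ "insert 0 G"]) auto
qed

section \<open>Basic sequences\<close>

text \<open>Grunblum's criterion with basis constant at most \<open>K\<close>. Only finite sums
  occur, so it can be checked before any convergence is known.\<close>

definition grunblum :: "real \<Rightarrow> (nat \<Rightarrow> 'a::real_normed_vector) \<Rightarrow> bool" where
  "grunblum K e \<longleftrightarrow> (\<forall>n. e n \<noteq> 0) \<and>
     (\<forall>a m n. m \<le> n \<longrightarrow> norm (\<Sum>i<m. a i *\<^sub>R e i) \<le> K * norm (\<Sum>i<n. a i *\<^sub>R e i))"

lemma grunblum_nonzero: "grunblum K e \<Longrightarrow> e n \<noteq> 0"
  by (simp add: grunblum_def)

lemma grunblumD:
  assumes "grunblum K e" "m \<le> n"
  shows "norm (\<Sum>i<m. a i *\<^sub>R e i) \<le> K * norm (\<Sum>i<n. a i *\<^sub>R e i)"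
  using assms by (simp add: grunblum_def)

text \<open>Asking for the expansion at all large \<open>n\<close> lets two elements of the span be
  expanded to a common length.\<close>

lemma in_span_range_nat_iff:
  "x \<in> span (range e) \<longleftrightarrow> (\<exists>a N. \<forall>n\<ge>N::nat. x = (\<Sum>i<n. a i *\<^sub>R e i))"
proof
  let ?S = "{x. \<exists>a N. \<forall>n\<ge>N. x = (\<Sum>i<n. a i *\<^sub>R e i)}"
  have "subspace ?S"
    unfolding subspace_def
  proof (safe, goal_cases)
    case 1
    show ?case by (rule exI[of _ "\<lambda>_. 0"]) simp
  next
    case (2 x y a b M N)
    have "\<forall>n\<ge>max M N. x + y = (\<Sum>i<n. (a i + b i) *\<^sub>R e i)"
    proof (intro allI impI)
      fix n assume "max M N \<le> n"
      then have "x = (\<Sum>i<n. a i *\<^sub>R e i)" "y = (\<Sum>i<n. b i *\<^sub>R e i)" using 2 by auto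
      then show "x + y = (\<Sum>i<n. (a i + b i) *\<^sub>R e i)" by (simp only: scaleR_add_left sum.distrib)
    qed
    then show ?case by (intro exI[of _ "\<lambda>i. a i + b i"] exI[of _ "max M N"])
  next
    case (3 c x a N)
    then have "\<forall>n\<ge>N. c *\<^sub>R x = (\<Sum>i<n. (c * a i) *\<^sub>R e i)"
      by (auto simp: scaleR_sum_right)
    then show ?case by (intro exI[of _ "\<lambda>i. c * a i"] exI[of _ N])
  qed
  moreover have "e k \<in> ?S" for k
  proof -
    have "\<forall>n\<ge>Suc k. e k = (\<Sum>i<n. (if i = k then 1 else 0) *\<^sub>R e i)"
      by (simp add: if_distrib[of "\<lambda>c. c *\<^sub>R _"] cong: if_cong)
    then show ?thesis by (intro CollectI exI[of _ "\<lambda>i. if i = k then 1 else 0"] exI[of _ "Suc k"])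
  qed
  ultimately have sub: "span (range e) \<subseteq> ?S" using span_minimal[of "range e" ?S] by blast
  assume "x \<in> span (range e)"
  with sub show "\<exists>a N. \<forall>n\<ge>N. x = (\<Sum>i<n. a i *\<^sub>R e i)" by (rule subsetD[THEN CollectD])
next
  assume "\<exists>a N. \<forall>n\<ge>N. x = (\<Sum>i<n. a i *\<^sub>R e i)"
  then obtain a N where "x = (\<Sum>i<N. a i *\<^sub>R e i)" by blast
  then show "x \<in> span (range e)" by (simp add: span_sum span_scale span_base)
qed

lemma grunblum_ge_1: assumes "grunblum K e" shows "K \<ge> 1"
proof -
  have "norm (e 0) \<le> K * norm (e 0)" using grunblumD[OF assms, of 1 1 "\<lambda>_. 1"] by simp
  then show ?thesis using grunblum_nonzero[OF assms, of 0] by simp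
qed

lemma grunblum_coeff_le:
  assumes "grunblum K e" "i < n"
  shows "\<bar>a i\<bar> * norm (e i) \<le> 2 * K * norm (\<Sum>i<n. a i *\<^sub>R e i)"
proof -
  let ?S = "\<lambda>m. \<Sum>i<m. a i *\<^sub>R e i"
  have le: "norm (?S m) \<le> K * norm (?S n)" if "m \<le> n" for m
    by (rule grunblumD[OF assms(1) that])
  have "\<bar>a i\<bar> * norm (e i) = norm (?S (Suc i) - ?S i)" by simp
  also have "\<dots> \<le> norm (?S (Suc i)) + norm (?S i)" by (rule norm_triangle_ineq4)
  finally show ?thesis using le[of "Suc i"] le[of i] assms(2) by simp
qed

text \<open>Approximants \<open>X k\<close> from the span have coefficients that are Cauchy in
  \<open>k\<close> for each index, by \<open>grunblum_coeff_le\<close>. The limits form an expansion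
  of \<open>x\<close> because the partial sum projections are bounded uniformly in their
  length.\<close>

theorem grunblum_imp_basic_sequence:
  fixes e :: "nat \<Rightarrow> 'a::banach"
  assumes g: "grunblum K e"
  shows "basic_sequence e"
  unfolding basic_sequence_def
proof
  have K1: "K \<ge> 1" by (rule grunblum_ge_1[OF g])
  note ne = grunblum_nonzero[OF g]
  note gr = grunblumD[OF g]
  fix x assume "x \<in> closure (span (range e))"
  then obtain X where X: "\<And>k. X k \<in> span (range e)" "X \<longlonglongrightarrow> x"
    unfolding closure_sequential by blast
  from X(1) have "\<forall>k. \<exists>a N. \<forall>n\<ge>N. X k = (\<Sum>i<n. a i *\<^sub>R e i)" by (simp add: in_span_range_nat_iff)
  then obtain a N where aN: "\<And>k n. n \<ge> N k \<Longrightarrow> X k = (\<Sum>i<n. a k i *\<^sub>R e i)" by metis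
  have diff: "X k - X l = (\<Sum>i<n. (a k i - a l i) *\<^sub>R e i)" if "n \<ge> N k" "n \<ge> N l" for k l n
    using aN[OF that(1)] aN[OF that(2)] by (simp add: scaleR_diff_left sum_subtractf)
  have part: "norm (\<Sum>i<m. (a k i - a l i) *\<^sub>R e i) \<le> K * norm (X k - X l)" for k l m
    using gr[of m "max m (max (N k) (N l))" "\<lambda>i. a k i - a l i"]
    by (subst diff[of k "max m (max (N k) (N l))" l]) auto
  have "convergent (\<lambda>k. a k i)" for i
  proof (rule real_Cauchy_convergent)
    have bd: "dist (a k i) (a l i) \<le> 2 * K / norm (e i) * dist (X k) (X l)" for k l
    proof -
      define n where "n = max (Suc i) (max (N k) (N l))"
      have "X k - X l = (\<Sum>i<n. (a k i - a l i) *\<^sub>R e i)" by (rule diff) (auto simp: n_def)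
      then have "\<bar>a k i - a l i\<bar> * norm (e i) \<le> 2 * K * norm (X k - X l)"
        using grunblum_coeff_le[OF g, of i n "\<lambda>i. a k i - a l i"] by (simp add: n_def)
      then show ?thesis using ne[of i] by (simp add: dist_norm dist_real_def field_simps)
    qed
    show "Cauchy (\<lambda>k. a k i)"
      unfolding Cauchy_def
    proof (intro allI impI)
      fix \<epsilon> :: real assume "\<epsilon> > 0"
      moreover have pos: "2 * K / norm (e i) > 0" using K1 ne[of i] by simp
      ultimately have "\<epsilon> / (2 * K / norm (e i)) > 0" by (rule divide_pos_pos)
      then obtain M where M: "\<forall>m\<ge>M. \<forall>n\<ge>M. dist (X m) (X n) < \<epsilon> / (2 * K / norm (e i))"
        using LIMSEQ_imp_Cauchy[OF X(2)] unfolding Cauchy_def by blast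
      show "\<exists>M. \<forall>m\<ge>M. \<forall>n\<ge>M. dist (a m i) (a n i) < \<epsilon>"
      proof (intro exI[of _ M] allI impI)
        fix m n assume "M \<le> m" "M \<le> n"
        then have "dist (X m) (X n) < \<epsilon> / (2 * K / norm (e i))" using M by blast
        then have "2 * K / norm (e i) * dist (X m) (X n) < \<epsilon>"
          using pos by (subst (asm) pos_less_divide_eq) (auto simp: mult.commute)
        with bd[of m n] show "dist (a m i) (a n i) < \<epsilon>" by linarith
      qed
    qed
  qed
  then obtain b where b: "\<And>i. (\<lambda>k. a k i) \<longlonglongrightarrow> b i" unfolding convergent_def by metis
  \<comment> \<open>The estimate \<open>part\<close> for \<open>l\<close> tending to infinity, with
    \<open>k\<close> and \<open>m\<close> fixed.\<close>
  have lim: "norm (\<Sum>i<m. (a k i - b i) *\<^sub>R e i) \<le> K * norm (X k - x)" for k m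
  proof (rule LIMSEQ_le)
    show "(\<lambda>l. norm (\<Sum>i<m. (a k i - a l i) *\<^sub>R e i)) \<longlonglongrightarrow> norm (\<Sum>i<m. (a k i - b i) *\<^sub>R e i)"
      by (intro tendsto_intros b)
    show "(\<lambda>l. K * norm (X k - X l)) \<longlonglongrightarrow> K * norm (X k - x)" by (intro tendsto_intros X(2))
  qed (use part in blast)
  have "(\<lambda>n. b n *\<^sub>R e n) sums x"
    unfolding sums_def
  proof (rule LIMSEQ_I)
    fix r :: real assume r: "r > 0"
    then have "r / (K + 1) > 0" using K1 by simp
    then obtain k where k: "norm (X k - x) < r / (K + 1)" using LIMSEQ_D[OF X(2)] by blast
    \<comment> \<open>First \<open>k\<close> is fixed; from length \<open>N k\<close> on,
      \<open>X k\<close> is its own partial sum. The two errors add up to at most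
      \<open>(1 + K) * norm (X k - x)\<close>.\<close>
    have "norm ((\<Sum>i<n. b i *\<^sub>R e i) - x) < r" if n: "n \<ge> N k" for n
    proof -
      have "(\<Sum>i<n. b i *\<^sub>R e i) - x = (X k - x) - (\<Sum>i<n. (a k i - b i) *\<^sub>R e i)"
        using aN[OF n] by (simp add: scaleR_diff_left sum_subtractf)
      also have "norm \<dots> \<le> norm (X k - x) + K * norm (X k - x)"
        using norm_triangle_ineq4[of "X k - x" "\<Sum>i<n. (a k i - b i) *\<^sub>R e i"] lim[where k = k and m = n] by linarith
      also have "\<dots> < r" using k K1 by (simp add: field_simps)
      finally show ?thesis .
    qed
    then show "\<exists>no. \<forall>n\<ge>no. norm ((\<Sum>i<n. b i *\<^sub>R e i) - x) < r" by blast
  qed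
  moreover have "c = b" if c: "(\<lambda>n. c n *\<^sub>R e n) sums x" and b: "(\<lambda>n. b n *\<^sub>R e n) sums x" for b c
  proof
    have "(\<lambda>n. (c n - b n) *\<^sub>R e n) sums 0"
      using sums_diff[OF c b] by (simp add: scaleR_diff_left)
    then have lim0: "(\<lambda>n. K * norm (\<Sum>i<n. (c i - b i) *\<^sub>R e i)) \<longlonglongrightarrow> K * norm (0::'a)"
      unfolding sums_def by (intro tendsto_intros)
    have z: "(\<Sum>i<m. (c i - b i) *\<^sub>R e i) = 0" for m
    proof -
      have "norm (\<Sum>i<m. (c i - b i) *\<^sub>R e i) \<le> K * norm (0::'a)"
        by (rule LIMSEQ_le_const[OF lim0]) (use gr[of m _ "\<lambda>i. c i - b i"] in auto)
      then show ?thesis by simp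
    qed
    fix i
    have "(c i - b i) *\<^sub>R e i = 0" using z[of "Suc i"] z[of i] by simp
    then show "c i = b i" using ne[of i] by simp
  qed
  ultimately show "\<exists>!a. (\<lambda>n. a n *\<^sub>R e n) sums x" by blast
qed

lemma grunblum_scale:
  assumes "grunblum K e" "\<And>n. c n \<noteq> 0"
  shows "grunblum K (\<lambda>n. c n *\<^sub>R e n)"
proof -
  have "norm (\<Sum>i<m. a i *\<^sub>R c i *\<^sub>R e i) \<le> K * norm (\<Sum>i<n. a i *\<^sub>R c i *\<^sub>R e i)" if "m \<le> n" for a m n
  proof -
    have "norm (\<Sum>i<m. (a i * c i) *\<^sub>R e i) \<le> K * norm (\<Sum>i<n. (a i * c i) *\<^sub>R e i)"
      by (rule grunblumD[OF assms(1) that])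
    then show ?thesis by simp
  qed
  then show ?thesis using assms by (simp add: grunblum_def)
qed

lemma grunblum_image:
  assumes g: "grunblum K e" and R: "linear R"
    and A: "\<And>x. norm (R x) \<le> A * norm x" and B: "\<And>x. norm x \<le> B * norm (R x)" and "A \<ge> 0"
  shows "grunblum (A * (K * B)) (\<lambda>n. R (e n))"
  unfolding grunblum_def
proof (intro conjI allI impI)
  fix n show "R (e n) \<noteq> 0"
    using B[of "e n"] g by (auto simp: grunblum_def)
next
  fix a and m n :: nat assume mn: "m \<le> n"
  have eq: "(\<Sum>i<k. a i *\<^sub>R R (e i)) = R (\<Sum>i<k. a i *\<^sub>R e i)" for k
    using R by (simp add: linear_sum linear_scale)
  have K0: "K \<ge> 0" using grunblum_ge_1[OF g] by simp
  have "norm (R (\<Sum>i<m. a i *\<^sub>R e i)) \<le> A * norm (\<Sum>i<m. a i *\<^sub>R e i)" by (rule A)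
  also have "\<dots> \<le> A * (K * norm (\<Sum>i<n. a i *\<^sub>R e i))"
    by (intro mult_left_mono grunblumD[OF g mn] \<open>A \<ge> 0\<close>)
  also have "\<dots> \<le> A * (K * (B * norm (R (\<Sum>i<n. a i *\<^sub>R e i))))"
    using \<open>A \<ge> 0\<close> K0 B by (intro mult_left_mono)
  finally show "norm (\<Sum>i<m. a i *\<^sub>R R (e i)) \<le> A * (K * B) * norm (\<Sum>i<n. a i *\<^sub>R R (e i))"
    unfolding eq by (simp add: mult.assoc)
qed

section \<open>The canonical embedding into the bidual and Mazur's selection\<close>

definition bidual_embedding :: "'a::real_normed_vector \<Rightarrow> ('a \<Rightarrow>\<^sub>L real) \<Rightarrow>\<^sub>L real" where
  "bidual_embedding x = Blinfun (\<lambda>f. blinfun_apply f x)"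

lemma bidual_embedding_apply [simp]: "blinfun_apply (bidual_embedding x) f = blinfun_apply f x"
  unfolding bidual_embedding_def
  by (subst bounded_linear_Blinfun_apply) (auto simp: blinfun.bounded_linear_left)

lemma linear_bidual_embedding: "linear bidual_embedding"
  by (intro linearI blinfun_eqI)
    (auto simp: blinfun.add_left blinfun.add_right blinfun.scaleR_left blinfun.scaleR_right)

lemmas bidual_embedding_simps =
  linear_add[OF linear_bidual_embedding] linear_scale[OF linear_bidual_embedding]
  linear_neg[OF linear_bidual_embedding] linear_sum[OF linear_bidual_embedding]

lemma norm_bidual_embedding [simp]: "norm (bidual_embedding x) = norm x"
proof (rule antisym)
  show "norm (bidual_embedding x) \<le> norm x"
  proof (rule norm_blinfun_bound)
    show "norm (bidual_embedding x f) \<le> norm x * norm f" for f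
      using norm_blinfun[of f x] by (simp add: mult.commute)
  qed simp
  obtain f where f: "norm f \<le> 1" "blinfun_apply f x = norm x" by (rule norming_functional)
  have "norm x \<le> norm (bidual_embedding x) * norm f"
    using norm_blinfun[of "bidual_embedding x" f] f(2) by simp
  also have "\<dots> \<le> norm (bidual_embedding x) * 1" using f(1) by (intro mult_left_mono) auto
  finally show "norm x \<le> norm (bidual_embedding x)" by simp
qed

lemma bounded_linear_bidual_embedding: "bounded_linear bidual_embedding"
  by (intro bounded_linear_intro[where K = 1]) (auto simp: bidual_embedding_simps)

text \<open>Each new point agrees with \<open>\<phi>\<close> on a finite set that norms, up to the
  factor 2, the span of \<open>\<phi>\<close> and the earlier points. Functionals from stage
  \<open>m\<close> therefore cannot distinguish the points \<open>x i\<close> with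
  \<open>i \<ge> m\<close> from \<open>\<phi>\<close>.\<close>

theorem mazur_selection:
  fixes \<phi> :: "('a::real_normed_vector \<Rightarrow>\<^sub>L real) \<Rightarrow>\<^sub>L real"
  assumes P: "\<And>G. finite G \<Longrightarrow> \<exists>x. P x \<and> (\<forall>g\<in>G. blinfun_apply g x = \<phi> g)"
  shows "\<exists>x. (\<forall>n::nat. P (x n)) \<and> (\<forall>a m n. m \<le> n \<longrightarrow>
       norm ((\<Sum>i<m. a i *\<^sub>R bidual_embedding (x i)) + (\<Sum>i\<in>{m..<n}. a i) *\<^sub>R \<phi>)
         \<le> 2 * norm (\<Sum>i<n. a i *\<^sub>R x i))"
proof -
  define good where "good B G x \<longleftrightarrow> finite B \<and> \<phi> \<in> B \<and> finite G \<and> (\<forall>g\<in>G. norm g \<le> 1) \<and>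
     (\<forall>\<psi>\<in>span B. \<exists>g\<in>G. norm \<psi> \<le> 2 * \<bar>blinfun_apply \<psi> g\<bar>) \<and> P x \<and> (\<forall>g\<in>G. blinfun_apply g x = \<phi> g)"
    for B G x
  have step: "\<exists>G x. good B G x \<and> G0 \<subseteq> G"
    if B: "finite B" "\<phi> \<in> B" and G0: "finite G0" "\<forall>g\<in>G0. norm g \<le> 1" for B G0
  proof -
    obtain G where G: "finite G" "\<forall>g\<in>G. norm g \<le> 1"
      "\<forall>\<psi>\<in>span B. \<exists>g\<in>G. norm \<psi> \<le> 2 * \<bar>blinfun_apply \<psi> g\<bar>"
      using finite_half_norming_set[OF B(1)] by blast
    obtain x where x: "P x" "\<forall>g\<in>G0 \<union> G. blinfun_apply g x = \<phi> g"
      using P[of "G0 \<union> G"] G(1) G0(1) by auto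
    have "good B (G0 \<union> G) x" unfolding good_def using B G G0 x by blast
    then show ?thesis by blast
  qed
  \<comment> \<open>The state is a triple of \<open>B\<close>, \<open>G\<close> and the chosen
    point. The sets \<open>G\<close> increase, so that later points agree with \<open>\<phi>\<close>
    on all earlier ones.\<close>
  define next_step where "next_step s s' \<longleftrightarrow>
      fst s' = insert (bidual_embedding (snd (snd s))) (fst s) \<and> fst (snd s) \<subseteq> fst (snd s')"
    for s s' :: "(('a \<Rightarrow>\<^sub>L real) \<Rightarrow>\<^sub>L real) set \<times> ('a \<Rightarrow>\<^sub>L real) set \<times> 'a"
  have "\<exists>s. \<forall>n. good (fst (s n)) (fst (snd (s n))) (snd (snd (s n))) \<and> next_step (s n) (s (Suc n))"
  proof (rule dependent_nat_choice)
    show "\<exists>s. good (fst s) (fst (snd s)) (snd (snd s))"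
      using step[of "{\<phi>}" "{}"] by auto
    fix s :: "(('a \<Rightarrow>\<^sub>L real) \<Rightarrow>\<^sub>L real) set \<times> ('a \<Rightarrow>\<^sub>L real) set \<times> 'a"
    assume s: "good (fst s) (fst (snd s)) (snd (snd s))"
    have "\<exists>G' x'. good (insert (bidual_embedding (snd (snd s))) (fst s)) G' x' \<and> fst (snd s) \<subseteq> G'"
      by (rule step) (use s in \<open>auto simp: good_def\<close>)
    then show "\<exists>s'. good (fst s') (fst (snd s')) (snd (snd s')) \<and> next_step s s'"
      by (auto simp: next_step_def)
  qed
  then obtain s where s: "\<And>n. good (fst (s n)) (fst (snd (s n))) (snd (snd (s n)))"
    "\<And>n. next_step (s n) (s (Suc n))" by blast
  define B where "B n = fst (s n)" for n
  define G where "G n = fst (snd (s n))" for n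
  define x where "x n = snd (snd (s n))" for n
  have good: "good (B n) (G n) (x n)" for n
    using s(1)[of n] by (simp add: B_def G_def x_def next_step_def)
  have B_Suc: "B (Suc n) = insert (bidual_embedding (x n)) (B n)" for n
    using s(2)[of n] by (simp add: B_def G_def x_def next_step_def)
  have "G n \<subseteq> G (Suc n)" for n using s(2)[of n] by (simp add: B_def G_def x_def next_step_def)
  then have G_mono: "G m \<subseteq> G n" if "m \<le> n" for m n using that by (rule lift_Suc_mono_le)
  have in_B: "bidual_embedding (x i) \<in> B m" if "i < m" for i m
    using that by (induction m) (auto simp: B_Suc less_Suc_eq)
  show ?thesis
  proof (intro exI[of _ x] conjI allI impI)
    show "P (x n)" for n using good[of n] by (simp add: good_def)
  next
    fix a and m n :: nat assume mn: "m \<le> n"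
    let ?w = "\<Sum>i<n. a i *\<^sub>R x i"
    let ?v = "(\<Sum>i<m. a i *\<^sub>R bidual_embedding (x i)) + (\<Sum>i\<in>{m..<n}. a i) *\<^sub>R \<phi>"
    have "\<phi> \<in> B m" using good[of m] by (simp add: good_def)
    then have "?v \<in> span (B m)"
      using in_B by (intro span_add span_sum span_scale span_base) auto
    \<comment> \<open>This \<open>g\<close> almost norms \<open>?v\<close> and takes the same value
      on \<open>?v\<close> and on \<open>?w\<close>.\<close>
    then obtain g where g: "g \<in> G m" "norm ?v \<le> 2 * \<bar>blinfun_apply ?v g\<bar>"
      using good[of m] unfolding good_def by blast
    have gx: "blinfun_apply g (x i) = \<phi> g" if "i \<ge> m" for i
      using G_mono[OF that] g(1) good[of i] by (auto simp: good_def)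
    have "blinfun_apply ?v g = (\<Sum>i<m. a i * g (x i)) + (\<Sum>i\<in>{m..<n}. a i * g (x i))"
      by (simp add: blinfun.add_left blinfun.sum_left blinfun.scaleR_left gx sum_distrib_right)
    also have "\<dots> = (\<Sum>i<n. a i * g (x i))"
      using sum.atLeastLessThan_concat[of 0 m n] mn by (simp add: lessThan_atLeast0)
    also have "\<dots> = g ?w" by (simp add: blinfun.sum_right blinfun.scaleR_right)
    also have "\<bar>g ?w\<bar> \<le> norm g * norm ?w" using norm_blinfun[of g ?w] by simp
    also have "\<dots> \<le> 1 * norm ?w"
      using good[of m] g(1) by (intro mult_right_mono) (auto simp: good_def)
    finally show "norm ?v \<le> 2 * norm ?w" using g(2) by simp
  qed
qed

text \<open>The case \<open>\<phi> = 0\<close>, in which the term with the tail coefficients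
  disappears.\<close>

corollary mazur_grunblum:
  fixes P :: "'a::real_normed_vector \<Rightarrow> bool"
  assumes "\<And>G. finite G \<Longrightarrow> \<exists>x\<in>common_kernel G. P x" and nz: "\<And>x. P x \<Longrightarrow> x \<noteq> 0"
  obtains x where "grunblum 2 x" "\<And>n. P (x n)"
proof -
  have "\<exists>x. P x \<and> (\<forall>g\<in>G. blinfun_apply g x = blinfun_apply (0 :: ('a \<Rightarrow>\<^sub>L real) \<Rightarrow>\<^sub>L real) g)" if "finite G" for G
    using assms(1)[OF that] by auto
  from mazur_selection[of P, OF this] obtain x where x: "\<And>n::nat. P (x n)"
    "\<And>a m n. m \<le> n \<Longrightarrow>
       norm ((\<Sum>i<m. a i *\<^sub>R bidual_embedding (x i)) + (\<Sum>i\<in>{m..<n}. a i) *\<^sub>R (0 :: ('a \<Rightarrow>\<^sub>L real) \<Rightarrow>\<^sub>L real))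
         \<le> 2 * norm (\<Sum>i<n. a i *\<^sub>R x i)"
    by blast
  have "(\<Sum>i<m. a i *\<^sub>R bidual_embedding (x i)) = bidual_embedding (\<Sum>i<m. a i *\<^sub>R x i)" for a m
    by (simp add: bidual_embedding_simps)
  then have "grunblum 2 x" using x nz unfolding grunblum_def by simp
  then show ?thesis using x(1) that by blast
qed

text \<open>The \<open>x n\<close> approximate a functional outside the canonical image of \<open>E\<close> in its bidual; its positive
  distance \<open>d\<close> from that image controls the coefficient sums \<open>a m + \<dots> + a (n - 1)\<close>.\<close>

lemma nonreflexive_basic_sequence:
  assumes "\<not> reflexive_space TYPE('e::banach)"
  obtains x :: "nat \<Rightarrow> 'e::banach" and f :: "'e \<Rightarrow>\<^sub>L real" and K C
  where "grunblum K x" "\<And>n. f (x n) = 1" "\<And>n. norm (x n) \<le> C"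
proof -
  obtain \<phi> :: "('e \<Rightarrow>\<^sub>L real) \<Rightarrow>\<^sub>L real" where "\<And>x. \<exists>f. \<phi> f \<noteq> blinfun_apply f x"
    using assms unfolding reflexive_space_def by blast
  then have \<phi>: "\<phi> \<notin> range bidual_embedding" by (auto simp: image_iff) (metis bidual_embedding_apply)
  have "complete (range (bidual_embedding :: 'e \<Rightarrow> _))"
    by (rule complete_isometric_image[of 1])
      (auto simp: bounded_linear_bidual_embedding complete_UNIV)
  then have cl: "closed (range (bidual_embedding :: 'e \<Rightarrow> _))" by (rule complete_imp_closed)
  define d where "d = infdist \<phi> (range bidual_embedding)"
  have d: "d > 0" unfolding d_def using infdist_pos_not_in_closed[OF cl _ \<phi>] by auto
  \<comment> \<open>Homogeneity: division by \<open>s\<close> turns the right-hand norm into a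
    distance from \<open>\<phi>\<close> to the image of the embedding.\<close>
  have dist: "\<bar>s\<bar> * d \<le> norm (bidual_embedding y + s *\<^sub>R \<phi>)" for s y
  proof (cases "s = 0")
    case False
    have "d \<le> dist \<phi> (bidual_embedding ((- 1 / s) *\<^sub>R y))" unfolding d_def by (rule infdist_le) simp
    also have "\<dots> = norm (\<phi> + (1 / s) *\<^sub>R bidual_embedding y)"
      by (simp add: dist_norm bidual_embedding_simps)
    finally have "\<bar>s\<bar> * d \<le> \<bar>s\<bar> * norm (\<phi> + (1 / s) *\<^sub>R bidual_embedding y)" by (rule mult_left_mono) simp
    also have "\<dots> = norm (s *\<^sub>R (\<phi> + (1 / s) *\<^sub>R bidual_embedding y))" by simp
    also have "s *\<^sub>R (\<phi> + (1 / s) *\<^sub>R bidual_embedding y) = bidual_embedding y + s *\<^sub>R \<phi>"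
      using False by (simp add: scaleR_add_right)
    finally show ?thesis .
  qed simp
  have "\<phi> \<noteq> bidual_embedding 0" using \<phi> by blast
  then obtain f0 where f0: "\<phi> f0 \<noteq> 0" by (metis blinfun_eqI bidual_embedding_apply blinfun.zero_right)
  define f where "f = (1 / \<phi> f0) *\<^sub>R f0"
  have f: "\<phi> f = 1" using f0 by (simp add: f_def blinfun.scaleR_right)
  define P where "P x \<longleftrightarrow> norm x \<le> norm \<phi> + 1 \<and> blinfun_apply f x = 1" for x
  have "\<exists>x. P x \<and> (\<forall>g\<in>G. blinfun_apply g x = \<phi> g)" if "finite G" for G
  proof -
    \<comment> \<open>Adding \<open>f\<close> to the set makes Helly's theorem fix
      \<open>f x = \<phi> f = 1\<close> as well.\<close>
    from that have "finite (insert f G)" by simp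
    then obtain x where "norm x \<le> norm \<phi> + 1" "\<And>g. g \<in> insert f G \<Longrightarrow> blinfun_apply g x = \<phi> g"
      by (rule helly[where \<phi> = \<phi>]) blast
    then show ?thesis using f by (intro exI[of _ x]) (auto simp: P_def)
  qed
  from mazur_selection[of P, OF this] obtain x where x: "\<And>n::nat. P (x n)"
    "\<And>a m n. m \<le> n \<Longrightarrow>
       norm ((\<Sum>i<m. a i *\<^sub>R bidual_embedding (x i)) + (\<Sum>i\<in>{m..<n}. a i) *\<^sub>R \<phi>)
         \<le> 2 * norm (\<Sum>i<n. a i *\<^sub>R x i)"
    by blast
  \<comment> \<open>The 2 comes from Mazur's selection; the other factor is the cost of removing
    \<open>s *\<^sub>R \<phi>\<close> from \<open>v\<close>, since
    \<open>\<bar>s\<bar> \<le> norm v / d\<close>.\<close>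
  define K where "K = (1 + norm \<phi> / d) * 2"
  have "grunblum K x"
    unfolding grunblum_def
  proof (intro conjI allI impI)
    fix n show "x n \<noteq> 0" using x(1)[of n] by (auto simp: P_def)
  next
    fix a and m n :: nat assume mn: "m \<le> n"
    define y where "y = (\<Sum>i<m. a i *\<^sub>R x i)"
    define s where "s = (\<Sum>i\<in>{m..<n}. a i)"
    define v where "v = bidual_embedding y + s *\<^sub>R \<phi>"
    have v: "norm v \<le> 2 * norm (\<Sum>i<n. a i *\<^sub>R x i)"
      using x(2)[OF mn, of a] by (simp add: v_def y_def s_def bidual_embedding_simps)
    have "norm y = norm (v - s *\<^sub>R \<phi>)" by (simp add: v_def)
    also have "\<dots> \<le> norm v + \<bar>s\<bar> * norm \<phi>" using norm_triangle_ineq4[of v "s *\<^sub>R \<phi>"] by simp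
    also have "\<bar>s\<bar> * norm \<phi> \<le> (norm v / d) * norm \<phi>"
      using dist[of s y] d by (intro mult_right_mono) (auto simp: v_def field_simps)
    also have "norm v + (norm v / d) * norm \<phi> = (1 + norm \<phi> / d) * norm v" by (simp add: field_simps)
    also have "\<dots> \<le> (1 + norm \<phi> / d) * (2 * norm (\<Sum>i<n. a i *\<^sub>R x i))"
      using d by (intro mult_left_mono v) simp
    finally show "norm (\<Sum>i<m. a i *\<^sub>R x i) \<le> K * norm (\<Sum>i<n. a i *\<^sub>R x i)"
      by (simp only: y_def K_def mult.assoc)
  qed
  then show ?thesis using x(1) that[of K x f "norm \<phi> + 1"] by (simp add: P_def)
qed

section \<open>Zabreiko's lemma and its consequences\<close>

lemma subspace_closure:
  fixes V :: "'a::real_normed_vector set"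
  assumes V: "subspace V"
  shows "subspace (closure V)"
  unfolding subspace_def
proof (intro conjI ballI allI)
  show "0 \<in> closure V" using closure_subset subspace_0[OF V] by blast
next
  fix x y assume "x \<in> closure V" "y \<in> closure V"
  then obtain X Y where "\<And>n. X n \<in> V" "X \<longlonglongrightarrow> x" "\<And>n. Y n \<in> V" "Y \<longlonglongrightarrow> y"
    unfolding closure_sequential by blast
  then show "x + y \<in> closure V"
    unfolding closure_sequential
    by (intro exI[of _ "\<lambda>n. X n + Y n"]) (auto intro: tendsto_add subspace_add[OF V])
next
  fix c x assume "x \<in> closure V"
  then obtain X where "\<And>n. X n \<in> V" "X \<longlonglongrightarrow> x" unfolding closure_sequential by blast
  then show "c *\<^sub>R x \<in> closure V"
    unfolding closure_sequential
    by (intro exI[of _ "\<lambda>n. c *\<^sub>R X n"]) (auto intro: tendsto_intros subspace_scale[OF V])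
qed

text \<open>By Baire, the closure of some sublevel set of \<open>q\<close> has interior in
  \<open>X\<close>. Successive approximation writes each small vector as a series of elements with
  geometrically decreasing \<open>q\<close>, and countable subadditivity removes the
  closure.\<close>

theorem zabreiko:
  fixes X :: "'a::banach set" and q :: "'a \<Rightarrow> real"
  assumes X: "subspace X" "closed X"
    and scale: "\<And>t x. x \<in> X \<Longrightarrow> q (t *\<^sub>R x) \<le> \<bar>t\<bar> * q x"
    and nonneg: "\<And>x. q x \<ge> 0"
    and subadd: "\<And>x s. (\<And>k::nat. x k \<in> X) \<Longrightarrow> summable (\<lambda>k. q (x k)) \<Longrightarrow> x sums s \<Longrightarrow>
                   q s \<le> (\<Sum>k. q (x k))"
  shows "\<exists>C>0. \<forall>x\<in>X. q x \<le> C * norm x"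
proof -
  have q0: "q 0 = 0" using scale[OF subspace_0[OF X(1)], of 0] nonneg[of 0] by simp
  have add: "q (u - v) \<le> q u + q v" if uv: "u \<in> X" "v \<in> X" for u v
  proof -
    \<comment> \<open>Finite subadditivity is obtained from a series with at most two nonzero
      terms.\<close>
    define w where "w k = (if k = 0 then u else if k = 1 then - v else 0)" for k :: nat
    have "w k \<in> X" for k using uv X(1) by (simp add: w_def subspace_0 subspace_neg)
    moreover have s: "(\<lambda>k. q (w k)) sums (\<Sum>k\<in>{0, 1}. q (w k))"
      by (rule sums_finite) (auto simp: w_def q0)
    moreover have "w sums (\<Sum>k\<in>{0, 1}. w k)" by (rule sums_finite) (auto simp: w_def)
    ultimately have "q (\<Sum>k\<in>{0, 1}. w k) \<le> (\<Sum>k. q (w k))" by (intro subadd) (auto simp: sums_iff)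
    also have "\<dots> = (\<Sum>k\<in>{0, 1}. q (w k))" using s by (simp add: sums_iff)
    finally show ?thesis using scale[OF uv(2), of "-1"] by (simp add: w_def)
  qed
  define A where "A n = {x \<in> X. q x \<le> real n}" for n
  have clA: "closure (A n) \<subseteq> X" for n by (rule closure_minimal) (auto simp: A_def X(2))
  have "X \<subseteq> (\<Union>n. closure (A n))"
  proof
    fix x assume "x \<in> X"
    then have "x \<in> A (nat \<lceil>q x\<rceil>)" by (simp add: A_def of_nat_ceiling)
    then show "x \<in> (\<Union>n. closure (A n))" using closure_subset by blast
  qed
  then have "X = (\<Union>n. closure (A n))" using clA by blast
  then have "top_of_set X interior_of (\<Union>(range (\<lambda>n. closure (A n)))) = X"
    using interior_of_topspace[of "top_of_set X"] by simp
  then have ne: "top_of_set X interior_of (\<Union>(range (\<lambda>n. closure (A n)))) \<noteq> {}"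
    using subspace_0[OF X(1)] by auto
  have "completely_metrizable_space (top_of_set X)"
    using X(2) by (simp add: completely_metrizable_space_closedin completely_metrizable_space_euclidean)
  then have "\<not> (\<forall>T\<in>range (\<lambda>n. closure (A n)). closedin (top_of_set X) T \<and> top_of_set X interior_of T = {})"
    using ne Baire_category_alt[of "top_of_set X" "range (\<lambda>n. closure (A n))"] by auto
  moreover have "closedin (top_of_set X) (closure (A n))" for n
    using clA by (simp add: closed_subset)
  ultimately obtain n where n: "top_of_set X interior_of closure (A n) \<noteq> {}" by blast
  then obtain z where "z \<in> top_of_set X interior_of closure (A n)" by blast
  then obtain W where W: "openin (top_of_set X) W" "z \<in> W" "W \<subseteq> closure (A n)"
    unfolding interior_of_def by blast
  then obtain U where U: "open U" "W = X \<inter> U" by (auto simp: openin_open)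
  then obtain r where r: "r > 0" "ball z r \<subseteq> U" using W(2) open_contains_ball by blast
  have zX: "z \<in> X" using U W by blast
  \<comment> \<open>Subtracting approximants of \<open>z + y\<close> and of \<open>z\<close>
    recentres the ball at 0 and doubles the bound \<open>n\<close>.\<close>
  define M where "M = 2 * real n"
  have approx: "\<exists>u\<in>X. q u \<le> M \<and> norm (y - u) < \<epsilon>" if y: "y \<in> X" "norm y < r" and \<epsilon>: "\<epsilon> > 0" for y \<epsilon>
  proof -
    have "z + y \<in> ball z r" "z \<in> ball z r" using y r(1) by (auto simp: dist_norm)
    moreover have "z + y \<in> X" using zX y(1) X(1) by (simp add: subspace_add)
    ultimately have "z + y \<in> closure (A n)" "z \<in> closure (A n)" using r W U zX by blast+
    then obtain u v where u: "u \<in> A n" "dist u (z + y) < \<epsilon> / 2" and v: "v \<in> A n" "dist v z < \<epsilon> / 2"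
      unfolding closure_approachable using \<epsilon> half_gt_zero by blast
    have "u - v \<in> X" using u v X(1) by (simp add: A_def subspace_diff)
    moreover have "q (u - v) \<le> M" using add[of u v] u v by (simp add: A_def M_def)
    moreover have "norm (y - (u - v)) < \<epsilon>"
    proof -
      have "y - (u - v) = (v - z) - (u - (z + y))" by simp
      then have "norm (y - (u - v)) \<le> norm (v - z) + norm (u - (z + y))" by (metis norm_triangle_ineq4)
      then show ?thesis using u v by (simp add: dist_norm)
    qed
    ultimately show ?thesis by blast
  qed
  have M0: "M \<ge> 0" by (simp add: M_def)
  have approx_scaled: "\<exists>u\<in>X. q u \<le> t * M \<and> norm (y - u) < t / 2 * r"
    if y: "y \<in> X" "norm y < t * r" and t: "t > 0" for y t
  proof -
    have "inverse t *\<^sub>R y \<in> X" using y X(1) by (simp add: subspace_scale)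
    moreover have "norm (inverse t *\<^sub>R y) < r" using y t by (simp add: field_simps)
    ultimately obtain u where u: "u \<in> X" "q u \<le> M" "norm (inverse t *\<^sub>R y - u) < r / 2"
      using approx[of "inverse t *\<^sub>R y" "r / 2"] r(1) by auto
    have "y - t *\<^sub>R u = t *\<^sub>R (inverse t *\<^sub>R y - u)" using t by (simp add: scaleR_diff_right)
    then have "norm (y - t *\<^sub>R u) = t * norm (inverse t *\<^sub>R y - u)" using t by simp
    also have "\<dots> < t * (r / 2)" using u(3) t by (rule mult_strict_left_mono)
    finally have "norm (y - t *\<^sub>R u) < t / 2 * r" by simp
    moreover have "q (t *\<^sub>R u) \<le> t * M"
    proof (rule order_trans)
      show "q (t *\<^sub>R u) \<le> t * q u" using scale[OF u(1), of t] t by simp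
      show "t * q u \<le> t * M" using u(2) t by (intro mult_left_mono) auto
    qed
    moreover have "t *\<^sub>R u \<in> X" using u(1) X(1) by (simp add: subspace_scale)
    ultimately show ?thesis by blast
  qed
  have small: "q y \<le> 2 * M" if y: "y \<in> X" "norm y < r" for y
  proof -
    \<comment> \<open>\<open>R k\<close> is the remainder after \<open>k\<close> approximations; the
      clause for \<open>k = 0\<close> makes the choice start at \<open>y\<close>, so the differences
      telescope to \<open>y\<close>.\<close>
    define Q where "Q k R \<longleftrightarrow> R \<in> X \<and> norm R < (1 / 2) ^ k * r \<and> (k = 0 \<longrightarrow> R = y)" for k R
    have "\<exists>R. \<forall>k. Q k (R k) \<and> q (R k - R (Suc k)) \<le> (1 / 2) ^ k * M"
    proof (rule dependent_nat_choice)
      show "\<exists>R. Q 0 R" using y by (auto simp: Q_def)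
      fix R k assume "Q k R"
      then have R: "R \<in> X" "norm R < (1 / 2) ^ k * r" by (auto simp: Q_def)
      obtain u where u: "u \<in> X" "q u \<le> (1 / 2) ^ k * M" "norm (R - u) < (1 / 2) ^ k / 2 * r"
        using approx_scaled[OF R] by auto
      then show "\<exists>R'. Q (Suc k) R' \<and> q (R - R') \<le> (1 / 2) ^ k * M"
        using R(1) X(1) by (intro exI[of _ "R - u"]) (simp add: Q_def subspace_diff)
    qed
    then obtain R where R: "\<And>k. R k \<in> X" "\<And>k. norm (R k) < (1 / 2) ^ k * r" "R 0 = y"
      "\<And>k. q (R k - R (Suc k)) \<le> (1 / 2) ^ k * M" unfolding Q_def by blast
    have geo: "(\<lambda>k. (1 / 2) ^ k * M) sums (2 * M)"
      using sums_mult2[OF geometric_sums[of "1 / 2 :: real"], of M] by simp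
    have sm: "summable (\<lambda>k. q (R k - R (Suc k)))"
      by (rule summable_comparison_test[OF _ sums_summable[OF geo]]) (use R(4) nonneg in auto)
    have "(\<lambda>k. (1 / 2) ^ k * r) \<longlonglongrightarrow> 0 * r" by (intro tendsto_mult_right LIMSEQ_power_zero) simp
    then have "R \<longlonglongrightarrow> 0"
      by (intro Lim_null_comparison[of R "\<lambda>k. (1 / 2) ^ k * r"]) (use R(2) in \<open>auto intro!: always_eventually less_imp_le\<close>)
    then have "(\<lambda>k. R k - R (Suc k)) sums (R 0 - 0)" by (rule telescope_sums')
    then have "(\<lambda>k. R k - R (Suc k)) sums y" using R(3) by simp
    then have "q y \<le> (\<Sum>k. q (R k - R (Suc k)))"
      by (intro subadd sm) (use R(1) X(1) in \<open>auto intro: subspace_diff\<close>)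
    also have "\<dots> \<le> (\<Sum>k. (1 / 2) ^ k * M)"
      by (rule suminf_le[OF R(4) sm sums_summable[OF geo]])
    also have "\<dots> = 2 * M" using geo by (simp add: sums_iff)
    finally show ?thesis .
  qed
  \<comment> \<open>Rescaling \<open>x\<close> to norm \<open>r / 2\<close> gives
    \<open>4 * M / r\<close>; the \<open>+ 1\<close> keeps \<open>C\<close> positive when
    \<open>M = 0\<close>.\<close>
  define C where "C = 4 * M / r + 1"
  have "q x \<le> C * norm x" if x: "x \<in> X" for x
  proof (cases "x = 0")
    case False
    define t where "t = r / (2 * norm x)"
    have t: "t > 0" using False r(1) by (simp add: t_def)
    have "norm (t *\<^sub>R x) < r" using False r(1) by (simp add: t_def)
    then have "q (t *\<^sub>R x) \<le> 2 * M" using x X(1) by (intro small) (auto intro: subspace_scale)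
    moreover have "q x \<le> inverse t * q (t *\<^sub>R x)"
      using scale[of "t *\<^sub>R x" "inverse t"] t x X(1) by (simp add: subspace_scale)
    ultimately have "q x \<le> inverse t * (2 * M)" using t
      by (meson inverse_nonnegative_iff_nonnegative less_imp_le mult_left_mono order_trans)
    also have "\<dots> = 4 * M / r * norm x" by (simp add: t_def)
    also have "\<dots> \<le> C * norm x" by (simp add: C_def distrib_right)
    finally show ?thesis .
  qed (simp add: q0)
  moreover have "C > 0" using M0 r(1) by (simp add: C_def add_nonneg_pos)
  ultimately show ?thesis by blast
qed

text \<open>Zabreiko's lemma is applied to the quotient norm \<open>q\<close> on the range. Series
  in the range with summable \<open>q\<close> lift to absolutely convergent series, which gives
  countable subadditivity.\<close>

theorem open_mapping_bound:
  fixes T :: "'a::banach \<Rightarrow> 'b::banach"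
  assumes T: "bounded_linear T" and cl: "closed (range T)"
  shows "\<exists>C>0. \<forall>x. \<exists>k. T k = 0 \<and> norm (x - k) \<le> C * norm (T x)"
proof -
  have lin: "linear T" by (rule bounded_linear.linear[OF T])
  \<comment> \<open>The value 0 off the range keeps \<open>q\<close> nonnegative everywhere, as
    \<open>zabreiko\<close> asks.\<close>
  define q where "q y = (if y \<in> range T then INF x\<in>T -` {y}. norm x else 0)" for y
  have bdd: "bdd_below (norm ` (T -` {y}))" for y by (rule bdd_belowI2[of _ 0]) simp
  have le: "q (T x) \<le> norm x" for x
    unfolding q_def by (auto intro!: cINF_lower bdd)
  have ex: "\<exists>x. T x = y \<and> norm x < q y + \<epsilon>" if "y \<in> range T" "\<epsilon> > 0" for y \<epsilon>
  proof -
    have "T -` {y} \<noteq> {}" using that by auto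
    moreover have "(INF x\<in>T -` {y}. norm x) < q y + \<epsilon>" using that by (simp add: q_def)
    ultimately show ?thesis using cINF_less_iff[OF _ bdd] by blast
  qed
  have nonneg: "q y \<ge> 0" for y
    unfolding q_def by (auto intro!: cINF_greatest)
  have "\<exists>C>0. \<forall>y\<in>range T. q y \<le> C * norm y"
  proof (rule zabreiko[OF _ cl _ nonneg])
    show "subspace (range T)" by (rule linear_subspace_image[OF lin subspace_UNIV])
  next
    fix t y assume y: "y \<in> range T"
    show "q (t *\<^sub>R y) \<le> \<bar>t\<bar> * q y"
    proof (rule field_le_epsilon)
      fix \<epsilon> :: real assume \<epsilon>: "\<epsilon> > 0"
      \<comment> \<open>The denominator \<open>\<bar>t\<bar> + 1\<close> also covers
        \<open>t = 0\<close>.\<close>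
      then obtain x where x: "T x = y" "norm x < q y + \<epsilon> / (\<bar>t\<bar> + 1)"
        using ex[OF y, of "\<epsilon> / (\<bar>t\<bar> + 1)"] by (auto simp: divide_pos_pos)
      have "q (t *\<^sub>R y) \<le> \<bar>t\<bar> * norm x" using le[of "t *\<^sub>R x"] x lin by (simp add: linear_scale)
      also have "\<dots> \<le> \<bar>t\<bar> * (q y + \<epsilon> / (\<bar>t\<bar> + 1))" using x(2) by (intro mult_left_mono) auto
      also have "\<dots> = \<bar>t\<bar> * q y + \<epsilon> * (\<bar>t\<bar> / (\<bar>t\<bar> + 1))" by (simp add: distrib_left)
      also have "\<dots> \<le> \<bar>t\<bar> * q y + \<epsilon> * 1" using \<epsilon> by (intro add_left_mono mult_left_mono) auto
      finally show "q (t *\<^sub>R y) \<le> \<bar>t\<bar> * q y + \<epsilon>" by simp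
    qed
  next
    fix y s assume y: "\<And>k::nat. y k \<in> range T" and sm: "summable (\<lambda>k. q (y k))" and s: "y sums s"
    show "q s \<le> (\<Sum>k. q (y k))"
    proof (rule field_le_epsilon)
      fix \<epsilon> :: real assume \<epsilon>: "\<epsilon> > 0"
      \<comment> \<open>The slacks form a geometric series with sum
        \<open>\<epsilon>\<close>.\<close>
      have "\<exists>x. T x = y k \<and> norm x < q (y k) + \<epsilon> / 2 * (1 / 2) ^ k" for k
        by (rule ex[OF y]) (use \<epsilon> in simp)
      then obtain x where x: "\<And>k. T (x k) = y k" "\<And>k. norm (x k) < q (y k) + \<epsilon> / 2 * (1 / 2) ^ k"
        by metis
      have geo: "(\<lambda>k. \<epsilon> / 2 * (1 / 2) ^ k) sums \<epsilon>"
        using sums_mult[OF geometric_sums[of "1 / 2 :: real"], of "\<epsilon> / 2"] by simp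
      have sm2: "summable (\<lambda>k. q (y k) + \<epsilon> / 2 * (1 / 2) ^ k)"
        by (intro summable_add sm sums_summable[OF geo])
      have smx: "summable x"
        by (rule summable_comparison_test[OF _ sm2]) (use x(2) in \<open>auto intro: less_imp_le\<close>)
      then have "(\<lambda>k. T (x k)) sums T (suminf x)"
        using bounded_linear.sums[OF T] summable_sums by blast
      then have "s = T (suminf x)" using s x(1) sums_unique2 by auto
      then have "q s \<le> norm (suminf x)" using le by simp
      also have "\<dots> \<le> (\<Sum>k. q (y k) + \<epsilon> / 2 * (1 / 2) ^ k)"
        by (rule norm_suminf_le[OF _ sm2]) (use x(2) in \<open>auto intro: less_imp_le\<close>)
      also have "\<dots> = (\<Sum>k. q (y k)) + \<epsilon>"
        using suminf_add[OF sm sums_summable[OF geo]] geo by (simp add: sums_iff)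
      finally show "q s \<le> (\<Sum>k. q (y k)) + \<epsilon>" .
    qed
  qed
  then obtain C where C: "C > 0" "\<And>x. q (T x) \<le> C * norm (T x)" by auto
  have "\<exists>k. T k = 0 \<and> norm (x - k) \<le> (C + 1) * norm (T x)" for x
  proof (cases "T x = 0")
    case True
    then show ?thesis by (intro exI[of _ x]) simp
  next
    case False
    \<comment> \<open>The infimum need not be attained; the slack \<open>norm (T x)\<close> is
      positive here and raises the constant to \<open>C + 1\<close>. The kernel element is
      \<open>x - u\<close>.\<close>
    then obtain u where u: "T u = T x" "norm u < q (T x) + norm (T x)" using ex[of "T x" "norm (T x)"] by auto
    show ?thesis
      by (rule exI[of _ "x - u"])
        (use u C(2)[of x] lin in \<open>auto simp: linear_diff algebra_simps\<close>)
  qed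
  then show ?thesis using C(1) by (intro exI[of _ "C + 1"]) simp
qed

text \<open>Zabreiko's lemma is applied to the supremum \<open>q\<close> of the norms of all partial
  sums. It is countably subadditive because the expansion of a sum with summable \<open>q\<close> is
  found by adding coefficients.\<close>

theorem basic_sequence_partial_sums_bound:
  fixes e :: "nat \<Rightarrow> 'a::banach"
  assumes e: "basic_sequence e"
  shows "\<exists>C>0. \<forall>a x m. (\<lambda>n. a n *\<^sub>R e n) sums x \<longrightarrow> norm (\<Sum>i<m. a i *\<^sub>R e i) \<le> C * norm x"
proof -
  define X where "X = closure (span (range e))"
  have X: "subspace X" "closed X" unfolding X_def by (auto intro: subspace_closure)
  have sums_X: "x \<in> X" if "(\<lambda>n. a n *\<^sub>R e n) sums x" for a x
    unfolding X_def closure_sequential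
    using that unfolding sums_def by (intro exI[of _ "\<lambda>n. \<Sum>i<n. a i *\<^sub>R e i"]) (simp add: span_sum span_scale span_base)
  have uniq: "a = b" if "(\<lambda>n. a n *\<^sub>R e n) sums x" "(\<lambda>n. b n *\<^sub>R e n) sums x" for a b x
    using e sums_X[OF that(1)] that unfolding basic_sequence_def X_def by blast
  have "\<forall>x\<in>X. \<exists>a. (\<lambda>n. a n *\<^sub>R e n) sums x"
    using e unfolding basic_sequence_def X_def by blast
  then obtain c where c: "\<And>x. x \<in> X \<Longrightarrow> (\<lambda>n. c x n *\<^sub>R e n) sums x" by metis
  \<comment> \<open>A zero vector would have an arbitrary coefficient, giving 0 two
    expansions.\<close>
  have ne: "e n \<noteq> 0" for n
  proof
    assume "e n = 0"
    then have "(\<lambda>k. (if k = n then 1 else 0) *\<^sub>R e k) = (\<lambda>k. 0 *\<^sub>R e k)" by auto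
    then have "(\<lambda>k. if k = n then 1 else 0 :: real) = (\<lambda>_. 0)"
      by (intro uniq[of _ 0]) auto
    then show False by (metis zero_neq_one)
  qed
  define S where "S x = (\<lambda>m. \<Sum>i<m. c x i *\<^sub>R e i)" for x
  define q where "q x = (if x \<in> X then SUP m. norm (S x m) else 0)" for x
  have lim: "S x \<longlonglongrightarrow> x" if "x \<in> X" for x using c[OF that] by (simp add: sums_def S_def)
  have bdd: "bdd_above (range (\<lambda>m. norm (S x m)))" if "x \<in> X" for x
  proof -
    have "Bseq (S x)" using lim[OF that] by (intro convergent_imp_Bseq) (auto simp: convergent_def)
    then obtain M where "\<And>m. norm (S x m) \<le> M" by (auto simp: Bseq_def)
    then show ?thesis by (rule bdd_aboveI2)
  qed
  have S_le: "norm (S x m) \<le> q x" if "x \<in> X" for x m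
    using that unfolding q_def by (auto intro!: cSUP_upper bdd)
  have q_le: "q x \<le> M" if "\<And>m. norm (S x m) \<le> M" "M \<ge> 0" for x M
    unfolding q_def using that by (auto intro!: cSUP_least)
  have nonneg: "q x \<ge> 0" for x
    using S_le[of x 0] by (cases "x \<in> X") (auto simp: S_def q_def)
  have norm_le: "norm x \<le> q x" if "x \<in> X" for x
    by (rule LIMSEQ_le_const2[OF tendsto_norm[OF lim[OF that]]]) (use S_le[OF that] in blast)
  have "\<exists>C>0. \<forall>x\<in>X. q x \<le> C * norm x"
  proof (rule zabreiko[OF X _ nonneg])
    fix t x assume x: "x \<in> X"
    have "(\<lambda>n. (t * c x n) *\<^sub>R e n) sums (t *\<^sub>R x)" using sums_scaleR_right[OF c[OF x], of t] by simp
    then have "c (t *\<^sub>R x) = (\<lambda>n. t * c x n)"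
      using x X(1) by (intro uniq[OF c]) (auto intro: subspace_scale)
    then have "S (t *\<^sub>R x) m = t *\<^sub>R S x m" for m by (simp add: S_def scaleR_sum_right)
    then show "q (t *\<^sub>R x) \<le> \<bar>t\<bar> * q x"
      using S_le[OF x] nonneg by (intro q_le) (auto intro: mult_left_mono)
  next
    fix x s assume x: "\<And>k::nat. x k \<in> X" and sm: "summable (\<lambda>k. q (x k))" and s: "x sums s"
    have smc: "summable (\<lambda>k. c (x k) i)" for i
    proof (rule summable_comparison_test)
      show "summable (\<lambda>k. 2 / norm (e i) * q (x k))" by (intro summable_mult sm)
      have "\<bar>c (x k) i\<bar> \<le> 2 / norm (e i) * q (x k)" for k
      proof -
        have "\<bar>c (x k) i\<bar> * norm (e i) = norm (S (x k) (Suc i) - S (x k) i)" by (simp add: S_def)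
        also have "\<dots> \<le> 2 * q (x k)"
          using norm_triangle_ineq4[of "S (x k) (Suc i)" "S (x k) i"] S_le[OF x, of k i] S_le[OF x, of k "Suc i"]
          by linarith
        finally show ?thesis using ne[of i] by (simp add: field_simps)
      qed
      then show "\<exists>N. \<forall>n\<ge>N. norm (c (x n) i) \<le> 2 / norm (e i) * q (x n)" by simp
    qed
    define b where "b i = (\<Sum>k. c (x k) i)" for i
    have smS: "summable (\<lambda>k. S (x k) m)" for m
      unfolding S_def by (intro summable_sum summable_scaleR_left smc)
    have part: "(\<Sum>i<m. b i *\<^sub>R e i) = (\<Sum>k. S (x k) m)" for m
      unfolding S_def b_def
      by (subst suminf_sum) (auto simp: suminf_scaleR_left smc intro!: summable_scaleR_left)
    have "(\<lambda>n. b n *\<^sub>R e n) sums s"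
      unfolding sums_def
    proof (rule LIMSEQ_I)
      fix r :: real assume r: "r > 0"
      \<comment> \<open>Past \<open>N\<close>, \<open>q\<close> dominates both the vectors and their
        partial sums, so each tail costs less than \<open>r / 3\<close> for every \<open>m\<close>.
        The finitely many expansions that remain converge as \<open>m\<close> grows.\<close>
      obtain N where N: "norm (\<Sum>k. q (x (k + N))) < r / 3"
        using suminf_exist_split[OF _ sm, of "r / 3"] r by auto
      have smN: "summable (\<lambda>k. q (x (k + N)))" by (rule summable_ignore_initial_segment[OF sm])
      have "(\<lambda>m. \<Sum>k<N. S (x k) m) \<longlonglongrightarrow> (\<Sum>k<N. x k)" by (intro tendsto_sum lim x)
      then obtain m0 where m0: "\<And>m. m \<ge> m0 \<Longrightarrow> norm ((\<Sum>k<N. S (x k) m) - (\<Sum>k<N. x k)) < r / 3"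
        using LIMSEQ_D[of _ _ "r / 3"] r by (meson divide_pos_pos zero_less_numeral)
      have "norm ((\<Sum>i<m. b i *\<^sub>R e i) - s) < r" if m: "m \<ge> m0" for m
      proof -
        have 1: "(\<Sum>i<m. b i *\<^sub>R e i) = (\<Sum>k. S (x (k + N)) m) + (\<Sum>k<N. S (x k) m)"
          unfolding part by (rule suminf_split_initial_segment[OF smS])
        have 2: "s = (\<Sum>k. x (k + N)) + (\<Sum>k<N. x k)"
          using suminf_split_initial_segment[of x N] s by (simp add: sums_iff)
        have 3: "norm (\<Sum>k. S (x (k + N)) m) \<le> (\<Sum>k. q (x (k + N)))"
          by (rule norm_suminf_le[OF S_le[OF x] smN])
        have 4: "norm (\<Sum>k. x (k + N)) \<le> (\<Sum>k. q (x (k + N)))"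
          by (rule norm_suminf_le[OF norm_le[OF x] smN])
        have "(\<Sum>i<m. b i *\<^sub>R e i) - s =
            ((\<Sum>k. S (x (k + N)) m) - (\<Sum>k. x (k + N))) + ((\<Sum>k<N. S (x k) m) - (\<Sum>k<N. x k))"
          unfolding 1 by (subst 2) simp
        also have "norm \<dots> \<le> norm (\<Sum>k. S (x (k + N)) m) + norm (\<Sum>k. x (k + N)) +
            norm ((\<Sum>k<N. S (x k) m) - (\<Sum>k<N. x k))"
          by (intro norm_triangle_le add_right_mono norm_triangle_ineq4)
        also have "\<dots> < r" using 3 4 N m0[OF m] by simp
        finally show ?thesis .
      qed
      then show "\<exists>no. \<forall>m\<ge>no. norm ((\<Sum>i<m. b i *\<^sub>R e i) - s) < r" by blast
    qed
    then have cs: "c s = b" using c[OF sums_X] uniq by blast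
    show "q s \<le> (\<Sum>k. q (x k))"
    proof (rule q_le)
      have "S s m = (\<Sum>k. S (x k) m)" for m using part[of m] by (simp add: S_def cs)
      then show "norm (S s m) \<le> (\<Sum>k. q (x k))" for m
        using norm_suminf_le[OF S_le[OF x] sm] by simp
      show "0 \<le> (\<Sum>k. q (x k))" by (rule suminf_nonneg[OF sm nonneg])
    qed
  qed
  then obtain C where C: "C > 0" "\<And>x. x \<in> X \<Longrightarrow> q x \<le> C * norm x" by blast
  have "norm (\<Sum>i<m. a i *\<^sub>R e i) \<le> C * norm x" if a: "(\<lambda>n. a n *\<^sub>R e n) sums x" for a x m
  proof -
    have xX: "x \<in> X" by (rule sums_X[OF a])
    have "a = c x" by (rule uniq[OF a c[OF xX]])
    then show ?thesis using S_le[OF xX, of m] C(2)[OF xX] by (simp add: S_def)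
  qed
  then show ?thesis using C(1) by blast
qed

text \<open>An approximant of \<open>x\<close> from the tail at \<open>m\<close> does not affect the
  first \<open>m\<close> coefficients, so the bound on partial sums of \<open>x - y\<close> forces
  the \<open>m\<close>-th partial sum of \<open>x\<close> to be 0.\<close>

lemma basic_sequence_tails_trivial:
  fixes e :: "nat \<Rightarrow> 'a::banach"
  assumes e: "basic_sequence e" and x: "\<And>m. x \<in> closure (span (e ` {m..}))"
  shows "x = 0"
proof -
  obtain C where C: "C > 0"
    "\<And>a x m. (\<lambda>n. a n *\<^sub>R e n) sums x \<Longrightarrow> norm (\<Sum>i<m. a i *\<^sub>R e i) \<le> C * norm x"
    using basic_sequence_partial_sums_bound[OF e] by blast
  have "e ` {0..} = range e" by auto
  then have "x \<in> closure (span (range e))" using x[of 0] by simp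
  then obtain a where a: "(\<lambda>n. a n *\<^sub>R e n) sums x" using e unfolding basic_sequence_def by blast
  have "(\<Sum>i<m. a i *\<^sub>R e i) = 0" for m
  proof (rule ccontr)
    assume nz: "(\<Sum>i<m. a i *\<^sub>R e i) \<noteq> 0"
    define \<epsilon> where "\<epsilon> = norm (\<Sum>i<m. a i *\<^sub>R e i) / C"
    have "\<epsilon> > 0" using nz C(1) by (simp add: \<epsilon>_def)
    then obtain y where y: "y \<in> span (e ` {m..})" "dist y x < \<epsilon>"
      using x[of m] unfolding closure_approachable by blast
    have "e ` {m..} = range (\<lambda>i. e (i + m))"
      by (auto simp: image_iff) (metis le_add_diff_inverse2)
    then have "y \<in> span (range (\<lambda>i. e (i + m)))" using y(1) by simp
    then obtain b N where b: "y = (\<Sum>i<N. b i *\<^sub>R e (i + m))"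
      unfolding in_span_range_nat_iff by blast
    \<comment> \<open>The tail coefficients are moved back to the indices from \<open>m\<close> to
      \<open>N + m - 1\<close> and padded with 0.\<close>
    define b' where "b' i = (if m \<le> i \<and> i < N + m then b (i - m) else 0)" for i
    have "(\<lambda>i. b' i *\<^sub>R e i) sums (\<Sum>i\<in>{m..<N + m}. b' i *\<^sub>R e i)"
      by (rule sums_finite) (auto simp: b'_def)
    also have "(\<Sum>i\<in>{m..<N + m}. b' i *\<^sub>R e i) = (\<Sum>i\<in>{0..<N}. b' (i + m) *\<^sub>R e (i + m))"
      using sum.shift_bounds_nat_ivl[of "\<lambda>i. b' i *\<^sub>R e i" 0 m N] by simp
    also have "\<dots> = y" unfolding b by (intro sum.cong) (auto simp: b'_def)
    finally have "(\<lambda>i. a i *\<^sub>R e i - b' i *\<^sub>R e i) sums (x - y)" by (rule sums_diff[OF a])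
    then have "(\<lambda>i. (a i - b' i) *\<^sub>R e i) sums (x - y)" by (simp add: scaleR_diff_left)
    from C(2)[OF this, of m] have "norm (\<Sum>i<m. (a i - b' i) *\<^sub>R e i) \<le> C * norm (x - y)" .
    also have "(\<Sum>i<m. (a i - b' i) *\<^sub>R e i) = (\<Sum>i<m. a i *\<^sub>R e i)"
      by (intro sum.cong) (auto simp: b'_def)
    also have "C * norm (x - y) < C * \<epsilon>"
      using y(2) C(1) by (intro mult_strict_left_mono) (auto simp: dist_norm norm_minus_commute)
    finally show False using C(1) by (simp add: \<epsilon>_def)
  qed
  then have "(\<lambda>n. a n *\<^sub>R e n) sums 0" by (simp add: sums_def)
  then show "x = 0" using a sums_unique2 by blast
qed

section \<open>Upper semi-Fredholm operators and small basic sequences\<close>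

text \<open>The kernel of \<open>T\<close> meets the common kernel only in 0, hence is
  finite-dimensional. The image of the common kernel is complete, and finitely many further vectors
  span the rest of the range.\<close>

lemma bounded_below_imp_upper_semi_fredholm:
  fixes T :: "'a::banach \<Rightarrow> 'b::real_normed_vector"
  assumes T: "bounded_linear T" and G: "finite G" and c: "c > 0"
    and below: "\<And>x. x \<in> common_kernel G \<Longrightarrow> c * norm x \<le> norm (T x)"
  shows "upper_semi_fredholm T"
proof -
  have lin: "linear T" by (rule bounded_linear.linear[OF T])
  let ?N = "common_kernel G"
  let ?K = "{x. T x = 0}"
  have "subspace ?K" by (simp add: subspace_def linear_0[OF lin] linear_add[OF lin] linear_scale[OF lin])
  then obtain B where B: "finite B" "?K \<subseteq> span (?K \<inter> ?N \<union> B)"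
    using finite_codim_common_kernel[OF G] by blast
  have "x = 0" if "x \<in> ?K \<inter> ?N" for x
  proof -
    have "c * norm x \<le> 0" using below[of x] that by simp
    then show ?thesis using c by (simp add: mult_le_0_iff)
  qed
  then have "?K \<inter> ?N \<union> B \<subseteq> insert 0 B" by blast
  then have "span (?K \<inter> ?N \<union> B) \<subseteq> span (insert 0 B)" by (rule span_mono)
  then have "?K \<subseteq> span (insert 0 B)" using B(2) by (rule order_trans[rotated])
  then have fd: "finite_dimensional_set ?K"
    unfolding finite_dimensional_set_def using B(1) by blast
  obtain D where D: "finite D" "(UNIV :: 'a set) \<subseteq> span (UNIV \<inter> ?N \<union> D)"
    using finite_codim_common_kernel[OF G subspace_UNIV] by blast
  then have "range T = T ` span (?N \<union> D)" by (simp add: top.extremum_unique)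
  also have "\<dots> = span (T ` ?N \<union> T ` D)" by (simp only: linear_span_image[OF lin] flip: image_Un)
  finally have range: "range T = span (T ` ?N \<union> T ` D)" .
  have "complete (T ` ?N)"
    by (rule complete_isometric_image[OF c subspace_common_kernel T])
      (use below closed_common_kernel in \<open>auto simp: complete_eq_closed\<close>)
  then have "closed (T ` ?N)" by (rule complete_imp_closed)
  moreover have "span (T ` ?N) = T ` ?N"
    using linear_subspace_image[OF lin subspace_common_kernel] span_eq_iff by blast
  ultimately have "closed (span (T ` ?N))" by (simp only:)
  then have "closed (span (T ` ?N \<union> T ` D))"
    by (rule closed_span_Un_finite) (use D(1) in simp)
  then show ?thesis using fd range by (simp add: upper_semi_fredholm_def)
qed

lemma small_basic_sequence_if_not_upper_semi_fredholm:
  fixes T :: "'a::banach \<Rightarrow> 'b::real_normed_vector"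
  assumes T: "bounded_linear T" and n: "\<not> upper_semi_fredholm T" and \<delta>: "\<delta> > 0"
  shows "\<exists>e. normalized_basic_sequence e \<and> (\<forall>n. norm (T (e n)) < \<delta>)"
proof -
  have "\<exists>x\<in>common_kernel G. norm x = 1 \<and> norm (T x) < \<delta>" if G: "finite G" for G
  proof (rule ccontr)
    assume "\<not> ?thesis"
    then have ge: "\<delta> \<le> norm (T x)" if "x \<in> common_kernel G" "norm x = 1" for x
      using that by force
    have "\<delta> * norm x \<le> norm (T x)" if x: "x \<in> common_kernel G" for x
    proof (cases "x = 0")
      case False
      have "inverse (norm x) *\<^sub>R x \<in> common_kernel G"
        using x by (rule subspace_scale[OF subspace_common_kernel])
      then have "\<delta> \<le> norm (T (inverse (norm x) *\<^sub>R x))" using False by (intro ge) auto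
      then show ?thesis
        using False bounded_linear.linear[OF T] by (simp add: linear_scale field_simps)
    qed simp
    with n bounded_below_imp_upper_semi_fredholm[OF T G \<delta>] show False by blast
  qed
  then obtain x where x: "grunblum 2 x" "\<And>n. norm (x n) = 1 \<and> norm (T (x n)) < \<delta>"
    by (rule mazur_grunblum) auto
  then show ?thesis
    using grunblum_imp_basic_sequence[OF x(1)] by (auto simp: normalized_basic_sequence_def)
qed

text \<open>Hahn--Banach applied to \<open>g \<mapsto> limsup g (e n)\<close> on the dual yields a functional which, by
  reflexivity, is evaluation at a point \<open>x\<close>; this replaces a weak cluster point of \<open>e\<close>.\<close>

lemma reflexive_basic_sequence_weakly_small:
  fixes e :: "nat \<Rightarrow> 'e::banach" and f :: "'e \<Rightarrow>\<^sub>L real"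
  assumes refl: "reflexive_space TYPE('e)" and e: "normalized_basic_sequence e" and c: "c > 0"
  shows "eventually (\<lambda>n. f (e n) < c) sequentially"
proof -
  have basic: "basic_sequence e" and n1: "norm (e n) = 1" for n
    using e by (auto simp: normalized_basic_sequence_def)
  \<comment> \<open>\<open>L g\<close> consists of the eventual upper bounds of
    \<open>g (e n)\<close>, so its infimum \<open>p g\<close> is the limit superior.\<close>
  define L where "L g = {t. eventually (\<lambda>n. blinfun_apply g (e n) \<le> t) sequentially}" for g :: "'e \<Rightarrow>\<^sub>L real"
  define p where "p g = Inf (L g)" for g
  have abs_le: "\<bar>g (e n)\<bar> \<le> norm g" for g :: "'e \<Rightarrow>\<^sub>L real" and n
    using norm_blinfun[of g "e n"] n1[of n] by simp
  have ne: "norm g \<in> L g" for g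
    unfolding L_def using abs_le_D1[OF abs_le[of g]] by simp
  have bdd: "bdd_below (L g)" for g
  proof (rule bdd_belowI)
    fix t assume "t \<in> L g"
    then obtain n where "g (e n) \<le> t" unfolding L_def using eventually_happens' sequentially_bot by blast
    with abs_le[of g n] show "- norm g \<le> t" by linarith
  qed
  have le: "p g \<le> t" if "t \<in> L g" for g t unfolding p_def by (rule cInf_lower[OF that bdd])
  have ge: "s \<le> p g" if "\<And>t. t \<in> L g \<Longrightarrow> s \<le> t" for g s
    unfolding p_def by (rule cInf_greatest) (use ne that in auto)
  have sub: "sublinear p"
  proof (rule sublinearI)
    fix g h
    have *: "p (g + h) \<le> s + t" if "s \<in> L g" "t \<in> L h" for s t
    proof (rule le)
      have "eventually (\<lambda>n. g (e n) \<le> s \<and> h (e n) \<le> t) sequentially"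
        using that by (simp add: L_def eventually_conj)
      then show "s + t \<in> L (g + h)"
        unfolding L_def by (auto elim!: eventually_mono simp: blinfun.add_left)
    qed
    have "p (g + h) - p h \<le> p g"
    proof (rule ge)
      fix s assume s: "s \<in> L g"
      have "p (g + h) - s \<le> p h"
        by (rule ge) (use *[OF s] in \<open>simp add: algebra_simps\<close>)
      then show "p (g + h) - p h \<le> s" by simp
    qed
    then show "p (g + h) \<le> p g + p h" by simp
  next
    fix t :: real and g assume t: "t > 0"
    have "p (t *\<^sub>R g) / t \<le> p g"
    proof (rule ge)
      fix s assume "s \<in> L g"
      then have "t * s \<in> L (t *\<^sub>R g)" using t by (simp add: L_def blinfun.scaleR_left)
      then have "p (t *\<^sub>R g) \<le> t * s" by (rule le)
      then show "p (t *\<^sub>R g) / t \<le> s" using t by (simp add: field_simps)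
    qed
    then show "p (t *\<^sub>R g) \<le> t * p g" using t by (simp add: field_simps)
  qed
  obtain \<phi> :: "('e \<Rightarrow>\<^sub>L real) \<Rightarrow>\<^sub>L real" where \<phi>: "\<And>g. \<phi> g \<le> p g" "\<phi> f = p f"
    by (rule hahn_banach_blinfun[OF sub, of 1]) (use le[OF ne] in auto)
  obtain x where x: "\<And>g. \<phi> g = blinfun_apply g x"
    using refl unfolding reflexive_space_def by blast
  have "x \<in> closure (span (e ` {m..}))" for m
  proof -
    let ?V = "span (e ` {m..})"
    \<comment> \<open>A functional that vanishes on the tail has limit superior at most 0, so
      \<open>h x \<le> 0\<close>; here \<open>h x\<close> is the distance of \<open>x\<close> to the
      tail.\<close>
    obtain h :: "'e \<Rightarrow>\<^sub>L real" where h: "\<And>y. y \<in> ?V \<Longrightarrow> h y = 0" "h x = infdist x ?V"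
      by (rule infdist_functional[OF subspace_span]) blast
    have "h (e n) = 0" if "n \<ge> m" for n using that by (intro h(1) span_base) auto
    then have "\<forall>n\<ge>m. h (e n) \<le> 0" by simp
    then have "0 \<in> L h" unfolding L_def eventually_sequentially by blast
    then have "infdist x ?V \<le> 0" using le[of 0 h] \<phi>(1)[of h] x[of h] h(2) by simp
    then have "infdist x ?V = 0" using infdist_nonneg[of x ?V] by simp
    moreover have "?V \<noteq> {}" using span_zero by blast
    ultimately show ?thesis by (simp add: in_closure_iff_infdist_zero)
  qed
  then have "x = 0" by (rule basic_sequence_tails_trivial[OF basic])
  then have "p f < c" using \<phi>(2) x[of f] c by simp
  then obtain t where "t \<in> L f" "t < c"
    unfolding p_def using cInf_lessD[of "L f" c] ne by blast
  then show ?thesis by (auto simp: L_def elim!: eventually_mono)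
qed

lemma upper_semi_fredholm_no_small_basic_sequence:
  fixes T :: "'e::banach \<Rightarrow> 'f::banach"
  assumes refl: "reflexive_space TYPE('e)" and T: "bounded_linear T" and usf: "upper_semi_fredholm T"
  shows "\<exists>\<delta>>0. \<not> (\<exists>e. normalized_basic_sequence e \<and> (\<forall>n. norm (T (e n)) < \<delta>))"
proof -
  from usf obtain B where B: "finite B" "{x. T x = 0} \<subseteq> span B" and cl: "closed (range T)"
    unfolding upper_semi_fredholm_def finite_dimensional_set_def by blast
  obtain C where C: "C > 0" "\<And>x. \<exists>k. T k = 0 \<and> norm (x - k) \<le> C * norm (T x)"
    using open_mapping_bound[OF T cl] by blast
  \<comment> \<open>The bound \<open>1 / (4 * C)\<close> puts \<open>e n\<close> within
    \<open>1 / 4\<close> of a kernel element \<open>k n\<close>. Along a subsequence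
    \<open>f\<close> exceeds \<open>1 / 2\<close> on \<open>k n\<close> but is below
    \<open>1 / 4\<close> on \<open>e n\<close>, too large a gap for
    \<open>norm f \<le> 1\<close>.\<close>
  have False if e: "normalized_basic_sequence e" and small: "\<And>n. norm (T (e n)) < 1 / (4 * C)" for e
  proof -
    have "\<exists>k. T k = 0 \<and> norm (e n - k) \<le> 1 / 4" for n
    proof -
      obtain k where k: "T k = 0" "norm (e n - k) \<le> C * norm (T (e n))" using C(2) by blast
      have "C * norm (T (e n)) \<le> C * (1 / (4 * C))"
        using small[of n] C(1) by (intro mult_left_mono) auto
      with k(2) have "norm (e n - k) \<le> 1 / 4" using C(1) by simp
      with k(1) show ?thesis by blast
    qed
    then obtain k where k: "\<And>n. T (k n) = 0" "\<And>n. norm (e n - k n) \<le> 1 / 4" by metis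
    have n1: "norm (e n) = 1" for n using e by (simp add: normalized_basic_sequence_def)
    have kn: "norm (k n) \<le> 2" "norm (k n) \<ge> 3 / 4" for n
      using norm_triangle_ineq2[of "k n" "e n"] norm_triangle_ineq2[of "e n" "k n"] k(2)[of n] n1[of n]
      by (auto simp: norm_minus_commute)
    have "seq_compact {x \<in> span B. norm x \<le> 2}"
      using compact_cball_span_finite[OF B(1)] compact_eq_seq_compact_metric by blast
    moreover have "\<forall>n. k n \<in> {x \<in> span B. norm x \<le> 2}" using k(1) kn B(2) by auto
    ultimately obtain l r where r: "strict_mono (r :: nat \<Rightarrow> nat)" "(k \<circ> r) \<longlonglongrightarrow> l"
      unfolding seq_compact_def by blast
    have "norm l \<ge> 3 / 4"
      by (rule LIMSEQ_le_const[OF tendsto_norm[OF r(2)]]) (use kn in auto)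
    obtain f :: "'e \<Rightarrow>\<^sub>L real" where f: "norm f \<le> 1" "f l = norm l" by (rule norming_functional)
    have "(\<lambda>n. f ((k \<circ> r) n)) \<longlonglongrightarrow> f l" by (intro tendsto_intros r(2))
    then have "eventually (\<lambda>n. f ((k \<circ> r) n) > 1 / 2) sequentially"
      by (rule order_tendstoD(1)) (use f(2) \<open>norm l \<ge> 3 / 4\<close> in simp)
    moreover have "eventually (\<lambda>n. f (e (r n)) < 1 / 4) sequentially"
      using eventually_subseq[OF r(1) reflexive_basic_sequence_weakly_small[OF refl e, of "1 / 4" f]] by simp
    ultimately have "eventually (\<lambda>n. f (k (r n)) > 1 / 2 \<and> f (e (r n)) < 1 / 4) sequentially"
      by (simp add: eventually_conj)
    then obtain n where n: "f (k (r n)) > 1 / 2" "f (e (r n)) < 1 / 4"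
      using eventually_happens' sequentially_bot by blast
    have "\<bar>f (e (r n) - k (r n))\<bar> \<le> norm f * norm (e (r n) - k (r n))"
      using norm_blinfun[of f "e (r n) - k (r n)"] by simp
    also have "\<dots> \<le> 1 * (1 / 4)" by (intro mult_mono f(1) k(2)) auto
    finally show False using n by (simp add: blinfun.diff_right)
  qed
  then show ?thesis using C(1) by (intro exI[of _ "1 / (4 * C)"]) auto
qed

text \<open>The coordinates are norming functionals \<open>h y\<close>, one for each vector
  \<open>y\<close>; the coordinate \<open>y = x\<close> attains the norm of \<open>x\<close>. The
  discrete topology makes every bounded function continuous, so the target is the space of all
  bounded functions on the given space.\<close>

lemma isometric_embedding_bcontfun_discrete:
  "\<exists>\<iota> :: 'a::real_normed_vector \<Rightarrow> ('a discrete \<Rightarrow>\<^sub>C real). bounded_linear \<iota> \<and> (\<forall>x. norm (\<iota> x) = norm x)"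
proof -
  have "\<exists>f :: 'a \<Rightarrow>\<^sub>L real. norm f \<le> 1 \<and> blinfun_apply f y = norm y" for y
    by (rule norming_functional[of y]) blast
  then obtain h :: "'a \<Rightarrow> 'a \<Rightarrow>\<^sub>L real" where h: "\<And>y. norm (h y) \<le> 1" "\<And>y. h y y = norm y" by metis
  have hle: "\<bar>h y x\<bar> \<le> norm x" for x y
  proof -
    have "\<bar>h y x\<bar> \<le> norm (h y) * norm x" using norm_blinfun[of "h y" x] by simp
    also have "\<dots> \<le> 1 * norm x" by (intro mult_right_mono h) simp
    finally show ?thesis by simp
  qed
  define \<iota> where "\<iota> x = Bcontfun (\<lambda>d. h (of_discrete d) x)" for x
  have app: "apply_bcontfun (\<iota> x) d = h (of_discrete d) x" for x d
  proof -
    have "continuous_on UNIV (\<lambda>d. h (of_discrete d) x)"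
      by (simp add: continuous_on_open_vimage open_discrete)
    then have "(\<lambda>d. h (of_discrete d) x) \<in> bcontfun"
      by (rule bcontfun_normI[where b = "norm x"]) (simp add: hle)
    then show ?thesis by (simp add: \<iota>_def Bcontfun_inverse)
  qed
  have norm: "norm (\<iota> x) = norm x" for x
  proof (rule antisym)
    show "norm (\<iota> x) \<le> norm x" by (rule norm_bound) (simp add: app hle)
    show "norm x \<le> norm (\<iota> x)"
      using norm_bounded[of "\<iota> x" "discrete x"] by (simp add: app h discrete_inverse)
  qed
  have "bounded_linear \<iota>"
    by (rule bounded_linear_intro[where K = 1])
      (auto intro!: bcontfun_eqI simp: app norm blinfun.add_right blinfun.scaleR_right)
  with norm show ?thesis by blast
qed

text \<open>The operator \<open>T\<close> has kernel \<open>span {z}\<close>, where \<open>f z = 1\<close>.  The rank-one perturbation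
  \<open>R u = \<epsilon> u + f u z\<close> is an isomorphism that maps \<open>x n\<close> to \<open>\<epsilon> x n + z\<close>, close to the kernel.\<close>

lemma nonreflexive_counterexample:
  assumes nr: "\<not> reflexive_space TYPE('e::banach)"
  shows "\<exists>T :: 'e::banach \<Rightarrow> ('e discrete \<Rightarrow>\<^sub>C real). bounded_linear T \<and> \<not> usf_iff_no_small_basic T"
proof -
  obtain x :: "nat \<Rightarrow> 'e" and f :: "'e \<Rightarrow>\<^sub>L real" and K C
    where x: "grunblum K x" "\<And>n. f (x n) = 1" "\<And>n. norm (x n) \<le> C"
    by (rule nonreflexive_basic_sequence[OF nr]) blast
  obtain \<iota> :: "'e \<Rightarrow> ('e discrete \<Rightarrow>\<^sub>C real)" where \<iota>: "bounded_linear \<iota>" "\<And>x. norm (\<iota> x) = norm x"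
    using isometric_embedding_bcontfun_discrete by blast
  define z where "z = x 0"
  have z: "f z = 1" "norm z \<le> C" using x by (auto simp: z_def)
  define T where "T u = \<iota> (u - f u *\<^sub>R z)" for u
  have T: "bounded_linear T"
    unfolding T_def
    by (rule bounded_linear_compose[OF \<iota>(1)])
      (intro bounded_linear_sub bounded_linear_ident bounded_linear_scaleR_const blinfun.bounded_linear_right)
  have normT: "norm (T u) = norm (u - f u *\<^sub>R z)" for u by (simp add: T_def \<iota>(2))
  have "upper_semi_fredholm T"
    unfolding upper_semi_fredholm_def
  proof
    have "u \<in> span {z}" if "T u = 0" for u
    proof -
      have "u = f u *\<^sub>R z" using normT[of u] that by simp
      then show ?thesis by (metis insertI1 span_base span_scale)
    qed
    then show "finite_dimensional_set {u. T u = 0}"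
      unfolding finite_dimensional_set_def by (intro exI[of _ "{z}"]) auto
    \<comment> \<open>\<open>u - f u *\<^sub>R z\<close> is a projection onto the kernel of
      \<open>f\<close>, because \<open>f z = 1\<close>.\<close>
    have "range T = \<iota> ` common_kernel {f}"
    proof (intro set_eqI iffI)
      fix w assume "w \<in> range T"
      then obtain u where "w = \<iota> (u - f u *\<^sub>R z)" by (auto simp: T_def)
      then show "w \<in> \<iota> ` common_kernel {f}"
        by (auto simp: blinfun.diff_right blinfun.scaleR_right z)
    next
      fix w assume "w \<in> \<iota> ` common_kernel {f}"
      then obtain u where "w = \<iota> u" "f u = 0" by auto
      then have "w = T u" by (simp add: T_def)
      then show "w \<in> range T" by simp
    qed
    moreover have "complete (\<iota> ` common_kernel {f})"
      by (rule complete_isometric_image[of 1, OF _ subspace_common_kernel \<iota>(1)])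
        (use closed_common_kernel[of "{f}"] \<iota>(2) in \<open>auto simp: complete_eq_closed\<close>)
    ultimately show "closed (range T)" by (simp add: complete_imp_closed)
  qed
  moreover have "\<exists>e. normalized_basic_sequence e \<and> (\<forall>n. norm (T (e n)) < \<delta>)" if \<delta>: "\<delta> > 0" for \<delta>
  proof -
    have C0: "C \<ge> 0" using x(3)[of 0] norm_ge_zero[of "x 0"] by linarith
    \<comment> \<open>Chosen so that \<open>norm f * (\<epsilon> * (2 * C)) < \<delta>\<close>; the
      \<open>+ 1\<close> makes the inequality strict and the denominator positive.\<close>
    define \<epsilon> where "\<epsilon> = \<delta> / (2 * C * norm f + 1)"
    have den: "2 * C * norm f + 1 > 0" using C0 by (intro add_nonneg_pos) auto
    have \<epsilon>: "\<epsilon> > 0" using \<delta> den by (simp add: \<epsilon>_def)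
    define R where "R u = \<epsilon> *\<^sub>R u + f u *\<^sub>R z" for u
    have "linear R"
      by (rule linearI) (auto simp: R_def blinfun.add_right blinfun.scaleR_right algebra_simps)
    have fle: "\<bar>f u\<bar> * norm z \<le> norm f * norm z * norm u" for u
      using mult_right_mono[OF norm_blinfun[of f u], of "norm z"] by (simp add: mult.commute mult.left_commute)
    have upper: "norm (R u) \<le> (\<epsilon> + norm f * norm z) * norm u" for u
    proof -
      have "norm (R u) \<le> \<epsilon> * norm u + \<bar>f u\<bar> * norm z"
        unfolding R_def using norm_triangle_ineq[of "\<epsilon> *\<^sub>R u" "f u *\<^sub>R z"] \<epsilon> by simp
      then show ?thesis using fle[of u] by (simp add: distrib_right)
    qed
    have lower: "norm u \<le> (1 + norm f * norm z) / \<epsilon> * norm (R u)" for u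
    proof -
      \<comment> \<open>\<open>R\<close> multiplies \<open>f\<close> by
        \<open>\<epsilon> + 1\<close>, so \<open>f u\<close> is controlled by \<open>R u\<close> and
        the rank-one term can be subtracted again.\<close>
      have fR: "f (R u) = (\<epsilon> + 1) * f u"
        by (simp add: R_def blinfun.add_right blinfun.scaleR_right z distrib_right)
      have "1 * \<bar>f u\<bar> \<le> (\<epsilon> + 1) * \<bar>f u\<bar>" using \<epsilon> by (intro mult_right_mono) auto
      then have "\<bar>f u\<bar> \<le> \<bar>f (R u)\<bar>" unfolding fR abs_mult using \<epsilon> by simp
      then have "\<bar>f u\<bar> * norm z \<le> \<bar>f (R u)\<bar> * norm z" by (rule mult_right_mono) simp
      also have "\<dots> \<le> norm f * norm z * norm (R u)" by (rule fle)
      finally have fz: "\<bar>f u\<bar> * norm z \<le> norm f * norm z * norm (R u)" .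
      have "\<epsilon> * norm u = norm (R u - f u *\<^sub>R z)" using \<epsilon> by (simp add: R_def)
      also have "\<dots> \<le> norm (R u) + \<bar>f u\<bar> * norm z" using norm_triangle_ineq4[of "R u" "f u *\<^sub>R z"] by simp
      finally have "\<epsilon> * norm u \<le> (1 + norm f * norm z) * norm (R u)" using fz by (simp add: distrib_right)
      then show ?thesis using \<epsilon> by (simp add: field_simps)
    qed
    define y where "y n = R (x n)" for n
    have y: "y n = \<epsilon> *\<^sub>R x n + z" for n by (simp add: y_def R_def x)
    obtain K' where "grunblum K' y"
      using grunblum_image[OF x(1) \<open>linear R\<close> upper lower] \<epsilon> unfolding y_def by auto
    \<comment> \<open>\<open>f (y n) = \<epsilon> + 1\<close> keeps \<open>y n\<close> away from 0;
      normalization costs at most the factor \<open>norm f\<close>.\<close>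
    have fy: "1 \<le> norm f * norm (y n)" for n
    proof -
      have "1 \<le> \<bar>f (y n)\<bar>" using \<epsilon> by (simp add: y x z blinfun.add_right blinfun.scaleR_right)
      also have "\<dots> \<le> norm f * norm (y n)" using norm_blinfun[of f "y n"] by simp
      finally show ?thesis .
    qed
    then have y0: "y n \<noteq> 0" for n by (metis mult_zero_right norm_zero not_one_le_zero)
    define e where "e n = (1 / norm (y n)) *\<^sub>R y n" for n
    have "grunblum K' e"
      unfolding e_def by (rule grunblum_scale[OF \<open>grunblum K' y\<close>]) (simp add: y0)
    then have "normalized_basic_sequence e"
      using y0 by (simp add: normalized_basic_sequence_def grunblum_imp_basic_sequence e_def)
    moreover have "norm (T (e n)) < \<delta>" for n
    proof -
      have "norm (T (y n)) = norm (\<epsilon> *\<^sub>R (x n - z))"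
        unfolding normT by (simp add: y x z blinfun.add_right blinfun.scaleR_right algebra_simps)
      also have "\<dots> \<le> \<epsilon> * (2 * C)"
        using norm_triangle_ineq4[of "x n" z] x(3)[of n] z(2) \<epsilon> by (simp add: mult_left_mono)
      finally have "norm (T (y n)) \<le> \<epsilon> * (2 * C)" .
      moreover have "1 / norm (y n) \<le> norm f" using fy[of n] y0[of n] by (simp add: field_simps)
      moreover have "norm (T (e n)) = 1 / norm (y n) * norm (T (y n))"
        unfolding e_def using bounded_linear.linear[OF T] by (simp add: linear_scale)
      ultimately have "norm (T (e n)) \<le> norm f * (\<epsilon> * (2 * C))"
        by (simp only:) (intro mult_mono, auto)
      also have "\<dots> = \<delta> * (2 * C * norm f) / (2 * C * norm f + 1)" by (simp add: \<epsilon>_def)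
      also have "\<dots> < \<delta>" using \<delta> den by (simp add: pos_divide_less_eq)
      finally show ?thesis .
    qed
    ultimately show ?thesis by blast
  qed
  ultimately have "\<not> usf_iff_no_small_basic T" unfolding usf_iff_no_small_basic_def by blast
  with T show ?thesis by blast
qed

text \<open>This makes the bounded functions an admissible target space in the next lemma.\<close>

instance bcontfun :: (metric_space, banach) banach ..

lemma reflexive_usf_iff_no_small_basic:
  fixes T :: "'e::banach \<Rightarrow> 'f::banach"
  assumes "reflexive_space TYPE('e)" "bounded_linear T"
  shows "usf_iff_no_small_basic T"
  unfolding usf_iff_no_small_basic_def
  using upper_semi_fredholm_no_small_basic_sequence[OF assms]
    small_basic_sequence_if_not_upper_semi_fredholm[OF assms(2)] by blast

text \<open>Types cannot be quantified inside a formula, so the target space \<open>F\<close>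
  appears as a type variable \<open>'f\<close>; the bounded functions on \<open>E\<close> are named
  separately as the target that carries the converse.\<close>

theorem theorem3p6:
  shows "reflexive_space TYPE('e::banach) \<longleftrightarrow>
    ((\<forall>T :: 'e \<Rightarrow> 'f::banach. bounded_linear T \<longrightarrow> usf_iff_no_small_basic T) \<and>
     (\<forall>T :: 'e \<Rightarrow> ('e discrete \<Rightarrow>\<^sub>C real). bounded_linear T \<longrightarrow> usf_iff_no_small_basic T))"
    (is "?R \<longleftrightarrow> ?A \<and> ?B")
proof
  assume refl: ?R
  show "?A \<and> ?B" by (intro conjI allI impI reflexive_usf_iff_no_small_basic[OF refl])
next
  assume "?A \<and> ?B"
  then have ?B ..
  then show ?R using nonreflexive_counterexample by blast
qed

end
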